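(* Let $\varepsilon\ge0$ and suppose the online regression oracle satisfies the square-loss regret bound $\mathsf{Reg}_{\mathrm{Sq}}(T)$ for $\mathcal F$. Then the algorithm SquareCB.Lin run with learning rate $\gamma = c\sqrt{dT/(\mathsf{Reg}_{\mathrm{Sq}}(T)+\varepsilon^2T)}$, with $c>0$ a fixed absolute constant, guarantees that for all sequences $S=(x_t,\mathcal A_t)_{t=1}^T$ with $\varepsilon_T(S)\le\varepsilon$, $$\mathsf{Reg}(T)=O\Big(\sqrt{d\,T\,\mathsf{Reg}_{\mathrm{Sq}}(T)}+\varepsilon\sqrt d\,T\Big).$$
   Context: Contextual bandit protocol. $\mathcal X$ is a set of contexts, $\mathcal A=\{a\in\mathbb R^d:\|a\|\le 1\}$, and $T$ is the horizon. At each round $t=1,\dots,T$ the learner observes $x_t\in\mathcal X$ and an action set $\mathcal A_t\subseteq\mathcal A$, chooses (possibly at random) $a_t\in\mathcal A_t$, and observes a stochastic loss $\ell_t\in[-1,1]$ whose conditional mean, given the past and $x_t,a_t$, is $\mu(a_t,x_t)$; $\mu$ is time-invariant and unknown. The sequence $S=(x_t,\mathcal A_t)_{t=1}^T$ is generated by an oblivious adversary. The learner has a class $\mathcal F$ of functions $f:\mathcal X\to\mathbb R^d$. Regret: $\mathsf{Reg}(T)=\mathbb E\big[\sum_{t=1}^T\mu(a_t,x_t)-\inf_{a\in\mathcal A_t}\mu(a,x_t)\big]$. Misspecification: $\varepsilon_T(S)=\inf_{f\in\mathcal F}\Big(\frac1T\sum_{t=1}^T\sup_{a\in\mathcal A_t}(\langle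 a,f(x_t)\rangle-\mu(a,x_t))^2\Big)^{1/2}$. Online regression oracle: a sequential algorithm which in each round receives $x_t$, outputs $\hat y_t\in\mathbb R^d$, then observes $a_t\in\mathcal A$, $\ell_t\in[-1,1]$, and which for every (potentially adaptively chosen) sequence satisfies $\sum_{t=1}^T(\langle a_t,\hat y_t\rangle-\ell_t)^2-\inf_{f\in\mathcal F}\sum_{t=1}^T(\langle a_t,f(x_t)\rangle-\ell_t)^2\le\mathsf{Reg}_{\mathrm{Sq}}(T)$, with $\mathsf{Reg}_{\mathrm{Sq}}$ non-data-dependent and non-decreasing in $T$. For a set $\mathcal B\subseteq\mathbb R^d$, $\Delta(\mathcal B)$ is the set of probability distributions on $\mathcal B$ with countable support; for $p\in\Delta(\mathcal B)$, $\bar a_p=\mathbb E_{a\sim p}[a]$ and $H_p=\mathbb E_{a\sim p}[aa^\top]$; $\dim(\mathcal B)$ is the dimension of the smallest affine subspace containing $\mathcal B$. $\mathsf{logdet\text{-}barrier}(\theta,\gamma;\mathcal B)$ is the set of minimizers over $p\in\Delta(\mathcal B)$ of $\langle\bar a_p,\theta\rangle-\gamma^{-1}\log\det(H_p-\bar a_p\bar a_p^\top)$, where, if $\dim(\mathcal B)<d$, $\det$ denotes the product of only the $\dim(\mathcal B)$ largest eigenvalues. SquareCB.Lin with learning rate $\gamma$: at each round $t$, receive $x_t$ (and $\mathcal A_t$), let $\hat\theta_t$ be the oracle's prediction $\hat y_t$ for $x_t$, sample $a_t\sim p_t$ where $p_t$ is any element of $\mathsf{logdet\text{-}barrier}(\hat\theta_t,\gamma;\mathcal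 A_t)$, play $a_t$, observe $\ell_t$, and update the oracle with $(x_t,a_t,\ell_t)$. *)

theory Defs
  imports
    "HOL-Probability.Probability"
    "HOL-Computational_Algebra.Computational_Algebra"
begin

section \<open>Contextual bandit protocol\<close>

text \<open>
  Rounds are \<open>t = 1, \<dots>, T\<close>. The adversary is oblivious, so contexts \<open>x t\<close> and action sets \<open>A t\<close>
  are deterministic, while actions \<open>a t\<close> and losses \<open>l t\<close> are random variables on \<open>M\<close>.
  \<open>H t\<close> is the information available to the learner at the beginning of round \<open>t\<close>: it
  contains all earlier actions and losses, and possibly private randomness of the learner.
\<close>

definition past_and_action ::
  "'w measure \<Rightarrow> 'w measure \<Rightarrow> ('w \<Rightarrow> 'v::topological_space) \<Rightarrow> 'w measure" where
  "past_and_action M G Y =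
     sigma (space M) (sets G \<union> {Y -` B \<inter> space M | B. B \<in> sets borel})"

text \<open>
  The assumption \<open>mean_range\<close> is what a mean of losses in \<open>[-1,1]\<close> satisfies; it is stated
  separately because the conditional means only constrain \<open>\<mu>\<close> at actions that are played.
\<close>

locale contextual_bandit = prob_space M
  for M :: "'w measure"
  and X :: "'x set"
  and T :: nat
  and x :: "nat \<Rightarrow> 'x"
  and A :: "nat \<Rightarrow> (real^'d) set"
  and \<mu> :: "real^'d \<Rightarrow> 'x \<Rightarrow> real"
  and H :: "nat \<Rightarrow> 'w measure"
  and a :: "nat \<Rightarrow> 'w \<Rightarrow> real^'d"
  and l :: "nat \<Rightarrow> 'w \<Rightarrow> real" +
  assumes horizon_pos: "1 \<le> T"
    and context_in: "t \<in> {1..T} \<Longrightarrow> x t \<in> X"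
    and action_set: "t \<in> {1..T} \<Longrightarrow> A t \<subseteq> {v. norm v \<le> 1}"
    and mean_range: "norm v \<le> 1 \<Longrightarrow> y \<in> X \<Longrightarrow> \<mu> v y \<in> {-1..1}"
    and past_filtration: "filtration (space M) H"
    and past_subalgebra: "subalgebra M (H t)"
    and action_adapted: "s \<in> {1..T} \<Longrightarrow> s < t \<Longrightarrow> a s \<in> borel_measurable (H t)"
    and loss_adapted: "s \<in> {1..T} \<Longrightarrow> s < t \<Longrightarrow> l s \<in> borel_measurable (H t)"
    and action_in: "t \<in> {1..T} \<Longrightarrow> \<omega> \<in> space M \<Longrightarrow> a t \<omega> \<in> A t"
    and loss_range: "t \<in> {1..T} \<Longrightarrow> \<omega> \<in> space M \<Longrightarrow> l t \<omega> \<in> {-1..1}"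
    and mean_measurable:
      "t \<in> {1..T} \<Longrightarrow> (\<lambda>\<omega>. \<mu> (a t \<omega>) (x t)) \<in> borel_measurable M"
    and loss_mean:
      "t \<in> {1..T} \<Longrightarrow>
        AE \<omega> in M. real_cond_exp M (past_and_action M (H t) (a t)) (l t) \<omega> = \<mu> (a t \<omega>) (x t)"

definition bandit_regret ::
  "'w measure \<Rightarrow> nat \<Rightarrow> (nat \<Rightarrow> 'x) \<Rightarrow> (nat \<Rightarrow> (real^'d) set) \<Rightarrow> (real^'d \<Rightarrow> 'x \<Rightarrow> real) \<Rightarrow>
   (nat \<Rightarrow> 'w \<Rightarrow> real^'d) \<Rightarrow> real" where
  "bandit_regret M T x A \<mu> a =
     (LINT \<omega>|M. (\<Sum>t=1..T. \<mu> (a t \<omega>) (x t) - (INF b\<in>A t. \<mu> b (x t))))"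

definition misspecification ::
  "('x \<Rightarrow> real^'d) set \<Rightarrow> (real^'d \<Rightarrow> 'x \<Rightarrow> real) \<Rightarrow> nat \<Rightarrow> (nat \<Rightarrow> 'x) \<Rightarrow>
   (nat \<Rightarrow> (real^'d) set) \<Rightarrow> real" where
  "misspecification F \<mu> T x A =
     (INF f\<in>F. sqrt (1 / real T * (\<Sum>t=1..T. SUP b\<in>A t. (b \<bullet> f (x t) - \<mu> b (x t))\<^sup>2)))"

section \<open>Online regression oracles\<close>

text \<open>A regression algorithm maps the list of past triples (context, action, loss) and the current
  context to a prediction.\<close>

type_synonym ('x, 'd) regression_oracle = "('x \<times> (real^'d) \<times> real) list \<Rightarrow> 'x \<Rightarrow> real^'d"

definition oracle_prediction ::
  "('x, 'd) regression_oracle \<Rightarrow> (nat \<Rightarrow> 'x) \<Rightarrow> (nat \<Rightarrow> real^'d) \<Rightarrow> (nat \<Rightarrow> real) \<Rightarrow> nat \<Rightarrow> real^'d" where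
  "oracle_prediction orc x a l t = orc (map (\<lambda>s. (x s, a s, l s)) [1..<t]) (x t)"

text \<open>As predictions are a function of the past, a bound for all fixed sequences also covers
  adaptively chosen ones.\<close>

definition square_loss_oracle ::
  "('x, 'd) regression_oracle \<Rightarrow> 'x set \<Rightarrow> ('x \<Rightarrow> real^'d) set \<Rightarrow> nat \<Rightarrow> real \<Rightarrow> bool" where
  "square_loss_oracle orc X F T R \<longleftrightarrow>
     (\<forall>x a l. (\<forall>t\<in>{1..T}. x t \<in> X \<and> norm (a t) \<le> 1 \<and> l t \<in> {-1..1}) \<longrightarrow>
        (\<Sum>t=1..T. (a t \<bullet> oracle_prediction orc x a l t - l t)\<^sup>2)
        - (INF f\<in>F. \<Sum>t=1..T. (a t \<bullet> f (x t) - l t)\<^sup>2) \<le> R)"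

section \<open>The log-determinant barrier\<close>

text \<open>A \<open>pmf\<close> is exactly a probability distribution with countable support.\<close>

definition distributions_on :: "(real^'d) set \<Rightarrow> (real^'d) pmf set" where
  "distributions_on B = {p. set_pmf p \<subseteq> B}"

definition mean_action :: "(real^'d) pmf \<Rightarrow> real^'d" where
  "mean_action p = measure_pmf.expectation p (\<lambda>v. v)"

definition outer :: "real^'d \<Rightarrow> real^'d \<Rightarrow> real^'d^'d" where
  "outer u v = (\<chi> i j. u $ i * v $ j)"

definition second_moment :: "(real^'d) pmf \<Rightarrow> real^'d^'d" where
  "second_moment p = measure_pmf.expectation p (\<lambda>v. outer v v)"

definition characteristic_poly :: "real^'d^'d \<Rightarrow> real poly" where
  "characteristic_poly S = det (\<chi> i j. (if i = j then [:0, 1:] else 0) - [:S $ i $ j:])"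

text \<open>Real eigenvalues in decreasing order, repeated according to multiplicity. It is only
  applied to symmetric matrices, which have all their eigenvalues in the reals.\<close>

definition eigenvalues_desc :: "real^'d^'d \<Rightarrow> real list" where
  "eigenvalues_desc S = rev (sorted_list_of_multiset (proots (characteristic_poly S)))"

definition barrier_det :: "(real^'d) set \<Rightarrow> real^'d^'d \<Rightarrow> real" where
  "barrier_det B S =
     (if aff_dim B < int CARD('d) then prod_list (take (nat (aff_dim B)) (eigenvalues_desc S))
      else det S)"

text \<open>Since \<open>ln 0 = 0\<close> on the reals, the logarithm is taken in the extended reals
  so that degenerate distributions have barrier \<open>\<infinity>\<close>.\<close>

definition ext_ln :: "real \<Rightarrow> ereal" where
  "ext_ln z = (if 0 < z then ereal (ln z) else -\<infinity>)"

definition logdet_objective ::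
  "real^'d \<Rightarrow> real \<Rightarrow> (real^'d) set \<Rightarrow> (real^'d) pmf \<Rightarrow> ereal" where
  "logdet_objective \<theta> \<gamma> B p =
     ereal (mean_action p \<bullet> \<theta>)
     - ereal (inverse \<gamma>) *
       ext_ln (barrier_det B (second_moment p - outer (mean_action p) (mean_action p)))"

text \<open>For \<open>\<gamma> = 0\<close> the conventions \<open>inverse 0 = 0\<close> and \<open>0 * (-\<infinity>) = 0\<close> remove the barrier: this
  is the objective for an infinite learning rate. In particular, a learning rate whose
  formula has denominator 0 (paper value \<open>\<infinity>\<close>, value 0 here) yields the greedy strategy.\<close>

definition logdet_barrier :: "real^'d \<Rightarrow> real \<Rightarrow> (real^'d) set \<Rightarrow> (real^'d) pmf set" where
  "logdet_barrier \<theta> \<gamma> B =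
     {p. is_arg_min (logdet_objective \<theta> \<gamma> B) (\<lambda>q. q \<in> distributions_on B) p}"

section \<open>The algorithm\<close>

text \<open>The actions \<open>a\<close> are generated by SquareCB.Lin with learning rate \<open>\<gamma>\<close>: in round \<open>t\<close>, the
  conditional distribution of \<open>a t\<close> given the past is some \<open>p t\<close> in the log-determinant barrier
  for the current prediction. The measurability conditions say that prediction
  and sampling distribution are random objects determined by the past.\<close>

definition squarecb_lin ::
  "'w measure \<Rightarrow> (nat \<Rightarrow> 'w measure) \<Rightarrow> nat \<Rightarrow> (nat \<Rightarrow> 'x) \<Rightarrow> (nat \<Rightarrow> (real^'d) set) \<Rightarrow>
   ('x, 'd) regression_oracle \<Rightarrow> real \<Rightarrow> (nat \<Rightarrow> 'w \<Rightarrow> real^'d) \<Rightarrow> (nat \<Rightarrow> 'w \<Rightarrow> real) \<Rightarrow> bool" where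
  "squarecb_lin M H T x A orc \<gamma> a l \<longleftrightarrow>
     (\<exists>\<theta> p. \<forall>t\<in>{1..T}.
        (\<forall>\<omega>\<in>space M. \<theta> t \<omega> = oracle_prediction orc x (\<lambda>s. a s \<omega>) (\<lambda>s. l s \<omega>) t) \<and>
        \<theta> t \<in> borel_measurable (H t) \<and>
        (\<forall>\<omega>\<in>space M. p t \<omega> \<in> logdet_barrier (\<theta> t \<omega>) \<gamma> (A t)) \<and>
        (\<forall>B\<in>sets borel.
           (\<lambda>\<omega>. measure_pmf.prob (p t \<omega>) B) \<in> borel_measurable (H t) \<and>
           (AE \<omega> in M. real_cond_exp M (H t) (\<lambda>\<omega>. indicator B (a t \<omega>)) \<omega>
                         = measure_pmf.prob (p t \<omega>) B)))"

end

theory Submission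
  imports Defs
begin

text \<open>
  Moving mass \<open>\<eta>\<close> of the minimiser \<open>p\<close> of the barrier problem to an action \<open>b\<close> changes the covariance
  \<open>\<Sigma>\<close> into \<open>(1 - \<eta>) (\<Sigma> + \<eta> u u\<^sup>T)\<close> with \<open>u = b - a\<^sub>p\<close>, and the first-order condition at \<open>\<eta> = 0\<close> reads
  \<open>u\<^sup>T \<Sigma>\<inverse> u \<le> d + \<gamma> \<langle>u, \<theta>\<rangle>\<close>. Cauchy--Schwarz and AM-GM turn this into
  \<open>\<langle>a\<^sub>p - b, f\<rangle> \<le> d / \<gamma> + \<gamma> / 4 * E\<^sub>p \<langle>a, \<theta> - f\<rangle>\<^sup>2\<close> for every \<open>f\<close>, and the sum over the rounds of the last
  term is at most \<open>2 Reg\<^sub>S\<^sub>q + 4 \<epsilon>\<^sup>2 T\<close> in expectation by the oracle bound. A degenerate action set, on which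
  \<open>\<Sigma>\<close> is singular, is treated by adding to \<open>\<Sigma>\<close> the projection onto the orthogonal complement of its
  affine hull: the product of the largest eigenvalues becomes an ordinary determinant.

  If \<open>Reg\<^sub>S\<^sub>q + \<epsilon>\<^sup>2 T = 0\<close>, there is no exploration. The oracle bound however holds for all sequences, so
  diverting a single round to an arbitrary action \<open>b\<close> with loss \<open>\<mu> b\<close> shows that the predictions are exact
  on unplayed actions too, and the greedy strategy has no regret.
\<close>

text \<open>Two features of the setting shape the probabilistic half. The oracle is constrained by
  its regret alone, so even integrability of the predictions has to be extracted from it. And the
  law of an action is known only as a conditional probability of Borel sets, whereas the integrands
  also contain the random \<theta>; they are polynomials in the action, so expanding them in
  coordinates separates coefficients known from the past from fixed functions of the action, to
  which the conditional law applies.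

  The infimum in the misspecification need not be attained, so the bounds are proved for every e >
  \<epsilon> with an f adapted to e, and e then decreases to \<epsilon>. The case of a zero
  denominator is separate because x / 0 = 0 turns the learning rate into 0 and so switches the
  barrier off. In the constant 2 (c + 1 / c), exploration costs 1 / c and estimation costs c; the
  misspecification of the comparator costs 2, which is at most c + 1 / c by AM-GM, and the factor 2
  adds up these two contributions.\<close>

no_notation fps_nth (infixl "$" 75)

section \<open>Symmetric matrices and the barrier determinant\<close>

lemma symmetric_dot:
  fixes S :: "real^'n^'n"
  assumes "transpose S = S"
  shows "x \<bullet> (S *v y) = (S *v x) \<bullet> y"
  by (metis assms dot_lmul_matrix vector_transpose_matrix)

section \<open>Spectral theorem for real symmetric matrices\<close>

lemma orthonormal_independent:
  fixes E :: "(real^'n) set"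
  assumes "pairwise orthogonal E" "\<And>e. e \<in> E \<Longrightarrow> norm e = 1"
  shows "independent E" "finite E"
proof -
  show "independent E"
    using assms by (intro pairwise_orthogonal_independent) force+
  then show "finite E"
    by (rule independent_imp_finite)
qed

text \<open>A maximiser x of the Rayleigh quotient on the unit vectors orthogonal to
  \<open>E\<close> is an eigenvector. Its residual r = S x - c x stays orthogonal to
  \<open>E\<close>, because \<open>E\<close> consists of eigenvectors of a symmetric matrix, so x
  may be perturbed along r; unless r = 0, the gain of first order contradicts maximality.\<close>

lemma orthonormal_eigenvector_extension:
  fixes S :: "real^'n^'n"
  assumes sym: "transpose S = S"
    and orth: "pairwise orthogonal E" and unit: "\<And>e. e \<in> E \<Longrightarrow> norm e = 1"
    and eig: "\<And>e. e \<in> E \<Longrightarrow> \<exists>c. S *v e = c *\<^sub>R e"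
    and card: "card E < CARD('n)"
  shows "\<exists>x c. norm x = 1 \<and> (\<forall>e\<in>E. orthogonal x e) \<and> S *v x = c *\<^sub>R x"
proof -
  have fin: "finite E"
    using orthonormal_independent[OF orth unit] by simp
  define U where "U = {x. norm x = 1 \<and> (\<forall>e\<in>E. orthogonal x e)}"
  have "dim E < DIM(real^'n)"
    using card dim_le_card'[OF fin] by simp
  then obtain z :: "real^'n" where z: "z \<noteq> 0" "\<And>y. y \<in> span E \<Longrightarrow> orthogonal z y"
    using orthogonal_to_subspace_exists by blast
  have "z /\<^sub>R norm z \<in> U"
    using z unfolding U_def by (auto simp: orthogonal_def span_base)
  then have U_ne: "U \<noteq> {}"
    by blast
  have "U = sphere 0 1 \<inter> (\<Inter>e\<in>E. {x. e \<bullet> x = 0})"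
    unfolding U_def by (auto simp: orthogonal_def inner_commute)
  then have "compact U"
    by (metis closed_INT closed_hyperplane compact_Int_closed compact_sphere)
  moreover have "continuous_on U (\<lambda>x. x \<bullet> (S *v x))"
    by (intro continuous_intros)
  ultimately obtain x where x: "x \<in> U" and max: "\<And>y. y \<in> U \<Longrightarrow> y \<bullet> (S *v y) \<le> x \<bullet> (S *v x)"
    using continuous_attains_sup[OF _ U_ne] by blast
  define c where "c = x \<bullet> (S *v x)"
  define r where "r = S *v x - c *\<^sub>R x"
  have xx: "x \<bullet> x = 1" and xE: "\<And>e. e \<in> E \<Longrightarrow> x \<bullet> e = 0"
    using x by (auto simp: U_def orthogonal_def norm_eq_1)
  have rE: "r \<bullet> e = 0" if "e \<in> E" for e
  proof -
    obtain b where "S *v e = b *\<^sub>R e"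
      using eig[OF \<open>e \<in> E\<close>] by blast
    then show ?thesis
      using xE[OF that] symmetric_dot[OF sym, of x e] by (simp add: r_def inner_diff_left)
  qed
  have rx: "r \<bullet> x = 0"
    using xx by (simp add: r_def c_def inner_diff_left inner_diff_right inner_commute)
  have quad: "y \<bullet> (S *v y) \<le> c * (y \<bullet> y)" if "\<And>e. e \<in> E \<Longrightarrow> y \<bullet> e = 0" for y
  proof (cases "y = 0")
    case False
    have "y /\<^sub>R norm y \<in> U"
      using that False by (auto simp: U_def orthogonal_def)
    from max[OF this] have "(y \<bullet> (S *v y)) / (norm y)\<^sup>2 \<le> c"
      by (simp add: c_def matrix_vector_mult_scaleR power2_eq_square divide_inverse mult_ac)
    then show ?thesis
      using False by (simp add: divide_le_eq power2_norm_eq_inner)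
  qed simp
  have Srr: "x \<bullet> (S *v r) = r \<bullet> r"
    using symmetric_dot[OF sym, of x r] rx by (simp add: r_def inner_diff_left inner_diff_right inner_commute)
  have le: "2 * s * (r \<bullet> r) \<le> s\<^sup>2 * (c * (r \<bullet> r) - r \<bullet> (S *v r))" for s :: real
  proof -
    have "(x + s *\<^sub>R r) \<bullet> (S *v (x + s *\<^sub>R r)) \<le> c * ((x + s *\<^sub>R r) \<bullet> (x + s *\<^sub>R r))"
      by (rule quad) (simp add: inner_add_left xE rE)
    moreover have "(x + s *\<^sub>R r) \<bullet> (S *v (x + s *\<^sub>R r)) = c + 2 * s * (r \<bullet> r) + s\<^sup>2 * (r \<bullet> (S *v r))"
      using Srr symmetric_dot[OF sym, of x r]
      by (simp add: c_def matrix_vector_mult_scaleR matrix_vector_right_distrib inner_add_left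
          inner_add_right inner_commute power2_eq_square algebra_simps)
    moreover have "(x + s *\<^sub>R r) \<bullet> (x + s *\<^sub>R r) = 1 + s\<^sup>2 * (r \<bullet> r)"
      using rx xx by (simp add: inner_add_left inner_add_right inner_commute power2_eq_square)
    ultimately have "c + 2 * s * (r \<bullet> r) + s\<^sup>2 * (r \<bullet> (S *v r)) \<le> c * (1 + s\<^sup>2 * (r \<bullet> r))"
      by (simp only:)
    then show ?thesis
      by (simp add: algebra_simps)
  qed
  have "r \<bullet> r = 0"
  proof (rule ccontr)
    assume "r \<bullet> r \<noteq> 0"
    then have pos: "r \<bullet> r > 0"
      by (simp add: less_le)
    \<comment> \<open>\<open>m\<close> is a positive bound of the second-order coefficient, and s =
      |r|^2 / m makes the second-order term at most s |r|^2, half of the first-order term.\<close>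
    define m where "m = \<bar>c * (r \<bullet> r) - r \<bullet> (S *v r)\<bar> + 1"
    define s where "s = (r \<bullet> r) / m"
    have m: "m > 0" "c * (r \<bullet> r) - r \<bullet> (S *v r) \<le> m"
      by (auto simp: m_def)
    have "s > 0" "s * m = r \<bullet> r"
      using pos m by (auto simp: s_def)
    have "2 * s * (r \<bullet> r) \<le> s\<^sup>2 * m"
      using le[of s] m mult_left_mono[of _ m "s\<^sup>2"] by fastforce
    also have "\<dots> = s * (r \<bullet> r)"
      using \<open>s * m = r \<bullet> r\<close> by (simp add: power2_eq_square)
    finally show False
      using \<open>s > 0\<close> pos by simp
  qed
  then have "S *v x = c *\<^sub>R x"
    by (simp add: r_def)
  then show ?thesis
    using x by (auto simp: U_def)
qed

lemma orthonormal_eigenbasis_extension_set: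
  fixes S :: "real^'n^'n"
  assumes "transpose S = S" "pairwise orthogonal E" "\<And>e. e \<in> E \<Longrightarrow> norm e = 1"
    "\<And>e. e \<in> E \<Longrightarrow> \<exists>c. S *v e = c *\<^sub>R e"
  shows "\<exists>E'. E \<subseteq> E' \<and> card E' = CARD('n) \<and> pairwise orthogonal E' \<and>
      (\<forall>e\<in>E'. norm e = 1 \<and> (\<exists>c. S *v e = c *\<^sub>R e))"
  using assms
proof (induction "CARD('n) - card E" arbitrary: E rule: less_induct)
  case less
  have ind: "independent E" and fin: "finite E"
    using orthonormal_independent less.prems by auto
  have le: "card E \<le> CARD('n)"
    using independent_bound[OF ind] by simp
  show ?case
  proof (cases "card E = CARD('n)")
    case True
    then show ?thesis
      using less.prems by (intro exI[of _ E]) auto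
  next
    case False
    then have lt: "card E < CARD('n)"
      using le by simp
    obtain x c where x: "norm x = 1" "\<forall>e\<in>E. orthogonal x e" "S *v x = c *\<^sub>R x"
      using orthonormal_eigenvector_extension[OF less.prems lt] by blast
    have "x \<notin> E"
      using x by (metis norm_eq_zero orthogonal_self zero_neq_one)
    then have c: "card (insert x E) = Suc (card E)"
      using fin by simp
    have "\<exists>E'. insert x E \<subseteq> E' \<and> card E' = CARD('n) \<and> pairwise orthogonal E' \<and>
      (\<forall>e\<in>E'. norm e = 1 \<and> (\<exists>c. S *v e = c *\<^sub>R e))"
    proof (rule less.hyps)
      show "CARD('n) - card (insert x E) < CARD('n) - card E"
        using c lt by simp
      show "pairwise orthogonal (insert x E)"
        using x less.prems(2) by (auto simp: pairwise_insert orthogonal_commute)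
    qed (use x less.prems in auto)
    then show ?thesis
      by blast
  qed
qed

text \<open>The prescribed eigenvectors \<open>E\<close> remain among the basis vectors; later this
  makes the basis compatible with the normal space of an action set.\<close>

lemma orthonormal_eigenbasis_extension:
  fixes S :: "real^'n^'n"
  assumes "transpose S = S" "pairwise orthogonal E" "\<And>e. e \<in> E \<Longrightarrow> norm e = 1"
    "\<And>e. e \<in> E \<Longrightarrow> \<exists>c. S *v e = c *\<^sub>R e"
  obtains q :: "'n \<Rightarrow> real^'n" and lam
  where "inj q" "\<And>i j. q i \<bullet> q j = (if i = j then 1 else 0)" "E \<subseteq> range q"
    "\<And>i. S *v q i = lam i *\<^sub>R q i"
proof -
  obtain E' where E': "E \<subseteq> E'" "card E' = CARD('n)" "pairwise orthogonal E'"
      "\<forall>e\<in>E'. norm e = 1 \<and> (\<exists>c. S *v e = c *\<^sub>R e)"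
    using orthonormal_eigenbasis_extension_set[OF assms] by blast
  have "finite E'"
    using E'(2) by (metis card.infinite zero_less_card_finite less_irrefl)
  then obtain q :: "'n \<Rightarrow> real^'n" where q: "bij_betw q UNIV E'"
    using finite_same_card_bij[of "UNIV :: 'n set" E'] E'(2) by auto
  then have rng: "range q = E'" and inj: "inj q"
    by (auto simp: bij_betw_def)
  have "\<forall>i. \<exists>c. S *v q i = c *\<^sub>R q i"
    using E'(4) rng by blast
  then obtain lam where lam: "\<And>i. S *v q i = lam i *\<^sub>R q i"
    by metis
  have "q i \<bullet> q j = (if i = j then 1 else 0)" for i j
  proof (cases "i = j")
    case True
    have "norm (q i) = 1"
      using E'(4) rng by blast
    then show ?thesis
      using True by (simp add: norm_eq_1)
  next
    case False
    have "q i \<in> E'" "q j \<in> E'"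
      using rng by auto
    moreover have "q i \<noteq> q j"
      using False inj by (simp add: inj_eq)
    ultimately show ?thesis
      using E'(3) False by (simp add: pairwise_def orthogonal_def)
  qed
  then show thesis
    using that[of q lam] inj rng E'(1) lam by blast
qed

text \<open>With the vectors \<open>q i\<close> as columns of Q, orthonormality gives (det Q)^2 = 1,
  so det Q cancels from the determinants of A Q = Q D.\<close>

lemma det_eq_prod_eigenvalues:
  fixes A :: "real^'n^'n" and q :: "'n \<Rightarrow> real^'n"
  assumes orth: "\<And>i j. q i \<bullet> q j = (if i = j then 1 else 0)"
    and eig: "\<And>i. A *v q i = lam i *\<^sub>R q i"
  shows "det A = (\<Prod>i\<in>UNIV. lam i)"
proof -
  define Q :: "real^'n^'n" where "Q = (\<chi> i j. q j $ i)"
  define D :: "real^'n^'n" where "D = (\<chi> i j. if i = j then lam i else 0)"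
  have "transpose Q ** Q = mat 1"
    using orth by (simp add: vec_eq_iff matrix_matrix_mult_def transpose_def Q_def mat_def
        inner_vec_def)
  then have "det Q * det Q = 1"
    by (metis det_I det_mul det_transpose)
  then have nz: "det Q \<noteq> 0"
    by auto
  have "(A ** Q) $ i $ j = (Q ** D) $ i $ j" for i j
  proof -
    have "(A ** Q) $ i $ j = (A *v q j) $ i"
      by (simp add: matrix_matrix_mult_def matrix_vector_mult_def Q_def)
    also have "\<dots> = (Q ** D) $ i $ j"
      by (simp add: eig matrix_matrix_mult_def Q_def D_def if_distrib cong: if_cong)
    finally show ?thesis .
  qed
  then have "A ** Q = Q ** D"
    by (simp add: vec_eq_iff)
  then have "det A * det Q = det D * det Q"
    by (metis det_mul mult.commute)
  moreover have "det D = (\<Prod>i\<in>UNIV. lam i)"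
    by (subst det_diagonal) (simp_all add: D_def)
  ultimately show ?thesis
    using nz by simp
qed

lemma poly_det:
  fixes P :: "real poly^'n^'n"
  shows "poly (det P) z = det (\<chi> i j. poly (P $ i $ j) z)"
  by (simp add: det_def poly_sum poly_mult poly_prod)

lemma characteristic_poly_eq_prod:
  fixes S :: "real^'d^'d" and q :: "'d \<Rightarrow> real^'d"
  assumes orth: "\<And>i j. q i \<bullet> q j = (if i = j then 1 else 0)"
    and eig: "\<And>i. S *v q i = lam i *\<^sub>R q i"
  shows "characteristic_poly S = (\<Prod>i\<in>UNIV. [:- lam i, 1:])"
proof -
  \<comment> \<open>Real polynomials that agree at every point are equal, and at a point z the
    matrix z I - S has the same eigenbasis with eigenvalues z - \<open>lam i\<close>.\<close>
  have "poly (characteristic_poly S) z = poly (\<Prod>i\<in>UNIV. [:- lam i, 1:]) z" for z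
  proof -
    have "poly (characteristic_poly S) z = det (\<chi> i j. (if i = j then z else 0) - S $ i $ j)"
      unfolding characteristic_poly_def poly_det
      by (rule arg_cong[where f = det]) (simp add: vec_eq_iff)
    also have "(\<chi> i j. (if i = j then z else 0) - S $ i $ j) = mat z - S"
      by (simp add: vec_eq_iff mat_def)
    also have "det (mat z - S) = (\<Prod>i\<in>UNIV. z - lam i)"
    proof (rule det_eq_prod_eigenvalues[OF orth])
      fix i
      have "mat z *v q i = z *\<^sub>R q i"
        by (simp add: vec_eq_iff matrix_vector_mult_def mat_def if_distrib if_distribR cong: if_cong)
      then show "(mat z - S) *v q i = (z - lam i) *\<^sub>R q i"
        using eig by (simp add: matrix_vector_mult_diff_rdistrib scaleR_diff_left)
    qed
    finally show ?thesis
      by (simp add: poly_prod)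
  qed
  then show ?thesis
    by (simp add: poly_eq_poly_eq_iff[symmetric] fun_eq_iff)
qed

lemma proots_characteristic_poly:
  fixes S :: "real^'d^'d" and q :: "'d \<Rightarrow> real^'d"
  assumes "\<And>i j. q i \<bullet> q j = (if i = j then 1 else 0)" "\<And>i. S *v q i = lam i *\<^sub>R q i"
  shows "proots (characteristic_poly S) = image_mset lam (mset_set UNIV)"
proof -
  have "proots (characteristic_poly S) = (\<Sum>i\<in>UNIV. proots [:- lam i, 1:])"
    unfolding characteristic_poly_eq_prod[OF assms] by (intro proots_prod) auto
  also have "\<dots> = (\<Sum>i\<in>UNIV. {#lam i#})"
    by (simp add: proots_linear_factor)
  also have "\<dots> = image_mset lam (mset_set UNIV)"
    by (simp add: sum_unfold_sum_mset)
  finally show ?thesis .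
qed

text \<open>Ascending order puts the \<open>n\<close> padding zeros in front of the nonnegative
  entries of \<open>M\<close>; after reversal they are exactly what \<open>take\<close> cuts
  off.\<close>

lemma prod_take_rev_sorted_list:
  fixes M :: "real multiset"
  assumes nonneg: "\<And>z. z \<in># M \<Longrightarrow> 0 \<le> z"
  shows "prod_list (take (size M) (rev (sorted_list_of_multiset (M + replicate_mset n 0)))) = prod_mset M"
proof -
  let ?ys = "replicate n 0 @ sorted_list_of_multiset M"
  have "sort ?ys = ?ys"
    using nonneg by (intro sorted_sort_id) (auto simp: sorted_append)
  moreover have "mset ?ys = M + replicate_mset n 0"
    by simp
  ultimately have "sorted_list_of_multiset (M + replicate_mset n 0) = ?ys"
    by (metis sorted_list_of_multiset_mset)
  moreover have "length (sorted_list_of_multiset M) = size M"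
    by (metis mset_sorted_list_of_multiset size_mset)
  moreover have "prod_list (rev (sorted_list_of_multiset M)) = prod_mset M"
    by (metis mset_rev mset_sorted_list_of_multiset prod_mset_prod_list)
  ultimately show ?thesis
    by simp
qed

section \<open>Matrix determinant lemma, by induction on the rows that carry the rank-one
  term\<close>

lemma det_replaced_row_aux:
  fixes u v :: "real^'n"
  assumes "finite F"
  shows "det (\<chi> i. if i = k then v else axis i 1 + (if i \<in> F then u $ i else 0) *s v) = v $ k"
  using assms
proof (induction F)
  case empty
  have "row i (mat 1 :: real^'n^'n) = axis i 1" for i
    by (simp add: vec_eq_iff row_def mat_def axis_def)
  moreover have "(\<Sum>i\<in>UNIV. v $ i *s axis i 1) = v"
    by (simp add: vec_eq_iff axis_def if_distrib cong: if_cong)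
  ultimately show ?case
    using cramer_lemma_transpose[of k v "mat 1"] by (simp cong: if_cong)
next
  case (insert j F)
  let ?A = "\<chi> i. if i = k then v else axis i 1 + (if i \<in> F then u $ i else 0) *s v"
  show ?case
  proof (cases "j = k")
    case True
    have "(\<chi> i. if i = k then v else axis i 1 + (if i \<in> insert j F then u $ i else 0) *s v) = ?A"
      using True by (simp add: vec_eq_iff)
    then show ?thesis
      using insert.IH by simp
  next
    case False
    \<comment> \<open>Row k is v, so the multiple of v in row j is produced by a row operation,
      which leaves the determinant unchanged.\<close>
    have "(\<chi> i. if i = k then v else axis i 1 + (if i \<in> insert j F then u $ i else 0) *s v)
        = (\<chi> i. if i = j then row j ?A + u $ j *s row k ?A else row i ?A)"
      using False insert.hyps by (auto simp: vec_eq_iff row_def)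
    then show ?thesis
      using det_row_operation[OF False, of ?A "u $ j"] insert.IH by simp
  qed
qed

text \<open>By linearity in row k, switching on the term u_k v of that row adds u_k times a
  determinant whose row k is v itself.\<close>

lemma det_id_plus_outer_aux:
  fixes u v :: "real^'n"
  assumes "finite F"
  shows "det (\<chi> i. axis i 1 + (if i \<in> F then u $ i else 0) *s v) = 1 + (\<Sum>i\<in>F. u $ i * v $ i)"
  using assms
proof (induction F)
  case empty
  have "(\<chi> i. axis i 1 + (if i \<in> {} then u $ i else 0) *s v) = mat 1"
    by (simp add: vec_eq_iff mat_def axis_def)
  then show ?case
    by (simp del: vector_smult_lzero)
next
  case (insert k F)
  let ?b = "\<lambda>i. axis i 1 + (if i \<in> F then u $ i else 0) *s v"
  have "(\<chi> i. axis i 1 + (if i \<in> insert k F then u $ i else 0) *s v)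
      = (\<chi> i. if i = k then ?b k + u $ k *s v else ?b i)"
    using insert.hyps by (auto simp: vec_eq_iff)
  then have "det (\<chi> i. axis i 1 + (if i \<in> insert k F then u $ i else 0) *s v)
      = det (\<chi> i. if i = k then ?b k else ?b i) + u $ k * det (\<chi> i. if i = k then v else ?b i)"
    using det_row_add[of k "\<lambda>_. ?b k" "\<lambda>_. u $ k *s v" ?b] det_row_mul[of k "u $ k" "\<lambda>_. v" ?b]
    by (simp only:)
  moreover have "(\<chi> i. if i = k then ?b k else ?b i) = (\<chi> i. ?b i)"
    by (simp add: vec_eq_iff)
  ultimately show ?case
    using insert det_replaced_row_aux[OF insert.hyps(1), of k v u] by (simp only: sum.insert) simp
qed

lemma det_id_plus_outer: "det (mat 1 + outer u v) = 1 + u \<bullet> v"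
proof -
  have "mat 1 + outer u v = (\<chi> i. axis i 1 + (if i \<in> UNIV then u $ i else 0) *s v)"
    by (simp add: vec_eq_iff mat_def axis_def outer_def)
  then show ?thesis
    using det_id_plus_outer_aux[of UNIV u v] by (simp add: inner_vec_def)
qed

text \<open>Symmetry turns K v = u into v^T K = u^T, hence K + u u^T = (1 + u v^T) K. The vector v
  stands for K^-1 u, so no inverse has to be formed.\<close>

lemma det_rank_one_update:
  fixes K :: "real^'d^'d"
  assumes "transpose K = K" "K *v v = u"
  shows "det (K + outer u u) = (1 + u \<bullet> v) * det K"
proof -
  have "u $ j = (\<Sum>k\<in>UNIV. v $ k * K $ k $ j)" for j
  proof -
    have "u $ j = (\<Sum>k\<in>UNIV. K $ j $ k * v $ k)"
      using assms(2) by (auto simp: matrix_vector_mult_def)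
    also have "\<dots> = (\<Sum>k\<in>UNIV. v $ k * K $ k $ j)"
      using assms(1) by (intro sum.cong) (auto simp: vec_eq_iff transpose_def)
    finally show ?thesis .
  qed
  then have "outer u v ** K = outer u u"
    by (simp add: vec_eq_iff outer_def matrix_matrix_mult_def sum_distrib_left mult.assoc)
  then have "(mat 1 + outer u v) ** K = K + outer u u"
    by (simp add: vec_eq_iff matrix_matrix_mult_def distrib_right sum.distrib)
      (simp add: mat_def if_distrib if_distribR cong: if_cong)
  then show ?thesis
    by (metis det_mul det_id_plus_outer)
qed

text \<open>The orthogonal complement of the direction space of the affine hull; using differences
  of points avoids the choice of a base point.\<close>

definition normal_space :: "'a::real_inner set \<Rightarrow> 'a set" where
  "normal_space B = {n. \<forall>v\<in>B. \<forall>w\<in>B. n \<bullet> (v - w) = 0}"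

lemma subspace_normal_space: "subspace (normal_space B)"
  by (auto simp: subspace_def normal_space_def inner_add_left)

text \<open>The direction space of the affine hull has dimension \<open>aff_dim B\<close> and its
  complement takes up the rest. For the empty set this fails: its \<open>aff_dim\<close> is -1, but
  its normal space is everything.\<close>

lemma dim_normal_space:
  fixes B :: "'a::euclidean_space set"
  assumes "B \<noteq> {}"
  shows "int (dim (normal_space B)) + aff_dim B = int DIM('a)"
proof -
  obtain b where b: "b \<in> B"
    using assms by blast
  define V where "V = span ((\<lambda>v. v - b) ` B)"
  have "normal_space B = {y \<in> UNIV. \<forall>x\<in>V. orthogonal x y}"
  proof (intro set_eqI iffI)
    fix n assume n: "n \<in> normal_space B"
    have "V \<subseteq> {x. n \<bullet> x = 0}"
      unfolding V_def using n b
      by (intro span_minimal subspace_hyperplane) (auto simp: normal_space_def)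
    then show "n \<in> {y \<in> UNIV. \<forall>x\<in>V. orthogonal x y}"
      by (auto simp: orthogonal_def inner_commute)
  next
    fix n assume n: "n \<in> {y \<in> UNIV. \<forall>x\<in>V. orthogonal x y}"
    have "n \<bullet> (v - b) = 0" if "v \<in> B" for v
      using n that span_base[of "v - b" "(\<lambda>v. v - b) ` B"]
      by (auto simp: V_def orthogonal_def inner_commute)
    then show "n \<in> normal_space B"
      by (auto simp: normal_space_def inner_diff_right)
  qed
  moreover have "dim {y \<in> UNIV. \<forall>x\<in>V. orthogonal x y} + dim V = dim (UNIV :: 'a set)"
    by (rule dim_subspace_orthogonal_to_vectors) (auto simp: V_def)
  moreover have "aff_dim B = int (dim V)"
    unfolding V_def dim_span by (rule aff_dim_eq_dim_subtract) (simp add: hull_inc b)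
  ultimately show ?thesis
    by simp
qed

section \<open>Projections and determinants on degenerate action sets\<close>

definition orth_projection :: "(real^'n) set \<Rightarrow> real^'n^'n" where
  "orth_projection E = (\<Sum>n\<in>E. outer n n)"

lemma outer_mult: "outer u v *v z = (v \<bullet> z) *\<^sub>R u"
  by (simp add: vec_eq_iff outer_def matrix_vector_mult_def inner_vec_def sum_distrib_left
      sum_distrib_right mult_ac)

lemma sum_matrix_vector_mult:
  fixes f :: "'a \<Rightarrow> real^'n^'m"
  shows "(\<Sum>i\<in>I. f i) *v z = (\<Sum>i\<in>I. f i *v z)"
  by (induction I rule: infinite_finite_induct) (auto simp: matrix_vector_mult_add_rdistrib)

lemma orth_projection_mult: "orth_projection E *v z = (\<Sum>n\<in>E. (n \<bullet> z) *\<^sub>R n)"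
  by (simp add: orth_projection_def sum_matrix_vector_mult outer_mult)

lemma symmetric_if_inner:
  fixes S :: "real^'n^'n"
  assumes "\<And>y z. y \<bullet> (S *v z) = z \<bullet> (S *v y)"
  shows "transpose S = S"
proof -
  have "S $ i $ j = S $ j $ i" for i j
    using assms[of "axis i 1" "axis j 1"] by (simp add: matrix_vector_mult_basis column_def inner_axis')
  then show ?thesis
    by (simp add: vec_eq_iff transpose_def)
qed

lemma matrix_eq_if_inner:
  fixes S R :: "real^'n^'n"
  assumes "\<And>y z. y \<bullet> (S *v z) = y \<bullet> (R *v z)"
  shows "S = R"
  using assms by (metis matrix_eq vector_eq_ldot)

lemma symmetric_orth_projection: "transpose (orth_projection E) = orth_projection E"
  by (rule symmetric_if_inner) (simp add: orth_projection_mult inner_sum_right inner_commute mult.commute)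

lemma transpose_add: "transpose (S + R) = transpose S + transpose R"
  by (simp add: vec_eq_iff transpose_def)

text \<open>Kernel vectors of \<open>S\<close> are eigenvectors, so \<open>E\<close> extends to a
  basis that diagonalises \<open>S\<close> and the projection at once; the projection has eigenvalue
  1 only on \<open>E\<close>, where \<open>S\<close> is forced to be 0.\<close>

lemma adapted_eigenbasis:
  fixes S :: "real^'n^'n"
  assumes "transpose S = S" "pairwise orthogonal E" "\<And>e. e \<in> E \<Longrightarrow> norm e = 1"
    and van: "\<And>e. e \<in> E \<Longrightarrow> S *v e = 0"
  obtains q :: "'n \<Rightarrow> real^'n" and lam
  where "inj q" "\<And>i j. q i \<bullet> q j = (if i = j then 1 else 0)" "E \<subseteq> range q"
    "\<And>i. S *v q i = lam i *\<^sub>R q i" "\<And>i. q i \<in> E \<Longrightarrow> lam i = 0"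
    "\<And>i. orth_projection E *v q i = (if q i \<in> E then 1 else 0) *\<^sub>R q i"
proof -
  have "\<exists>c. S *v e = c *\<^sub>R e" if "e \<in> E" for e
    using van[OF that] by (intro exI[of _ 0]) simp
  then obtain q :: "'n \<Rightarrow> real^'n" and lam
    where q: "inj q" "\<And>i j. q i \<bullet> q j = (if i = j then 1 else 0)" "E \<subseteq> range q"
    "\<And>i. S *v q i = lam i *\<^sub>R q i"
    using orthonormal_eigenbasis_extension[OF assms(1-3)] by metis
  have "lam i = 0" if "q i \<in> E" for i
    using q(2)[of i i] q(4)[of i] van[OF that] by auto
  moreover have "orth_projection E *v q i = (if q i \<in> E then 1 else 0) *\<^sub>R q i" for i
  proof -
    have "finite E"
      using assms orthonormal_independent by blast
    have "orth_projection E *v q i = (\<Sum>n\<in>E. if n = q i then q i else 0)"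
      unfolding orth_projection_mult using q(2,3) by (intro sum.cong) auto
    then show ?thesis
      using \<open>finite E\<close> by simp
  qed
  ultimately show thesis
    using that q by blast
qed

lemma card_vimage_range: "inj q \<Longrightarrow> E \<subseteq> range q \<Longrightarrow> card {i. q i \<in> E} = card E"
  by (metis card_vimage_inj vimage_def)

lemma card_not_vimage:
  fixes q :: "'n::finite \<Rightarrow> 'b"
  assumes "inj q" "E \<subseteq> range q"
  shows "card {i. q i \<notin> E} + card E = CARD('n)"
proof -
  have "UNIV = {i. q i \<notin> E} \<union> {i. q i \<in> E}"
    by auto
  then have "CARD('n) = card ({i. q i \<notin> E} \<union> {i. q i \<in> E})"
    by (rule arg_cong)
  then show ?thesis
    using card_vimage_range[OF assms] by (subst (asm) card_Un_disjoint) auto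
qed

text \<open>The projection is not scaled, so only the eigendirections outside \<open>E\<close>
  contribute a factor \<open>r\<close>.\<close>

lemma det_scaled_plus_projection:
  fixes S :: "real^'n^'n"
  assumes "transpose S = S" "pairwise orthogonal E" "\<And>e. e \<in> E \<Longrightarrow> norm e = 1"
    "\<And>e. e \<in> E \<Longrightarrow> S *v e = 0"
  shows "det (r *\<^sub>R S + orth_projection E) = r ^ (CARD('n) - card E) * det (S + orth_projection E)"
proof -
  obtain q :: "'n \<Rightarrow> real^'n" and lam
    where q: "inj q" "\<And>i j. q i \<bullet> q j = (if i = j then 1 else 0)" "E \<subseteq> range q"
      "\<And>i. S *v q i = lam i *\<^sub>R q i" "\<And>i. q i \<in> E \<Longrightarrow> lam i = 0"
      "\<And>i. orth_projection E *v q i = (if q i \<in> E then 1 else 0) *\<^sub>R q i"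
    using adapted_eigenbasis[OF assms] by metis
  have d: "det (s *\<^sub>R S + orth_projection E) = (\<Prod>i\<in>UNIV. if q i \<in> E then 1 else s * lam i)" for s
  proof (rule det_eq_prod_eigenvalues[OF q(2)])
    fix i
    show "(s *\<^sub>R S + orth_projection E) *v q i = (if q i \<in> E then 1 else s * lam i) *\<^sub>R q i"
      using q(4-6) by (simp add: matrix_vector_mult_add_rdistrib flip: scaleR_matrix_vector_assoc)
  qed
  have c: "card {i. q i \<notin> E} = CARD('n) - card E"
    using card_not_vimage[OF q(1,3)] by simp
  have p: "(\<Prod>i\<in>UNIV. if q i \<in> E then 1 else s * lam i) = s ^ (CARD('n) - card E) * (\<Prod>i | q i \<notin> E. lam i)" for s
  proof -
    have "(\<Prod>i\<in>UNIV. if q i \<in> E then 1 else s * lam i) = (\<Prod>i | q i \<notin> E. s * lam i)"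
      by (subst prod.mono_neutral_right[of UNIV "{i. q i \<notin> E}"]) auto
    then show ?thesis
      by (simp add: prod.distrib c)
  qed
  show ?thesis
    using d[of r] d[of 1] p[of r] p[of 1] by simp
qed

lemma det_pos:
  fixes A :: "real^'n^'n"
  assumes "transpose A = A" "\<And>z. z \<noteq> 0 \<Longrightarrow> 0 < z \<bullet> (A *v z)"
  shows "0 < det A"
proof -
  obtain q :: "'n \<Rightarrow> real^'n" and lam
    where q: "\<And>i j. q i \<bullet> q j = (if i = j then 1 else 0)" "\<And>i. A *v q i = lam i *\<^sub>R q i"
    by (rule orthonormal_eigenbasis_extension[OF assms(1), of "{}"]) (blast | simp)+
  have "0 < lam i" for i
    using assms(2)[of "q i"] q(1)[of i i] q(2)[of i] by fastforce
  then show ?thesis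
    using det_eq_prod_eigenvalues[OF q] by (simp add: prod_pos)
qed

text \<open>By semidefiniteness the \<open>card E\<close> zero eigenvalues on \<open>E\<close> are
  among the smallest, so the \<open>aff_dim B\<close> largest are those off \<open>E\<close>. The
  projection raises the zeros on \<open>E\<close> to ones and leaves the others alone. Determinant
  formulas thus apply to degenerate action sets without a change of dimension.\<close>

lemma barrier_det_eq_det:
  fixes S :: "real^'d^'d"
  assumes sym: "transpose S = S" and psd: "\<And>z. 0 \<le> z \<bullet> (S *v z)"
    and E: "pairwise orthogonal E" "\<And>e. e \<in> E \<Longrightarrow> norm e = 1"
    and van: "\<And>e. e \<in> E \<Longrightarrow> S *v e = 0"
    and card: "int (card E) + aff_dim B = int CARD('d)"
  shows "barrier_det B S = det (S + orth_projection E)"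
proof (cases "aff_dim B < int CARD('d)")
  case False
  have "finite E"
    using E orthonormal_independent by blast
  moreover have "card E = 0"
    using False card by linarith
  ultimately have "E = {}"
    by simp
  then show ?thesis
    using False by (simp add: barrier_det_def orth_projection_def)
next
  case True
  obtain q :: "'d \<Rightarrow> real^'d" and lam
    where q: "inj q" "\<And>i j. q i \<bullet> q j = (if i = j then 1 else 0)" "E \<subseteq> range q"
      "\<And>i. S *v q i = lam i *\<^sub>R q i" "\<And>i. q i \<in> E \<Longrightarrow> lam i = 0"
      "\<And>i. orth_projection E *v q i = (if q i \<in> E then 1 else 0) *\<^sub>R q i"
    using adapted_eigenbasis[OF sym E van] by metis
  define M where "M = image_mset lam (mset_set {i. q i \<notin> E})"
  have c: "card {i. q i \<notin> E} + card E = CARD('d)"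
    by (rule card_not_vimage[OF q(1,3)])
  have "proots (characteristic_poly S) = image_mset lam (mset_set ({i. q i \<notin> E} \<union> {i. q i \<in> E}))"
    using proots_characteristic_poly[OF q(2,4)] by (simp add: Collect_neg_eq Compl_eq_Diff_UNIV Un_commute)
  also have "\<dots> = M + image_mset lam (mset_set {i. q i \<in> E})"
    unfolding M_def by (subst mset_set_Union) auto
  also have "image_mset lam (mset_set {i. q i \<in> E}) = image_mset (\<lambda>_. 0) (mset_set {i. q i \<in> E})"
    using q(5) by (intro image_mset_cong) auto
  also have "\<dots> = replicate_mset (card E) 0"
    by (simp add: image_mset_const_eq card_vimage_range[OF q(1,3)])
  finally have "proots (characteristic_poly S) = M + replicate_mset (card E) 0" .
  moreover have "nat (aff_dim B) = size M"
    using c card by (simp add: M_def)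
  moreover have "0 \<le> z" if z: "z \<in># M" for z
  proof -
    obtain i where "z = lam i"
      using z by (auto simp: M_def)
    then show ?thesis
      using psd[of "q i"] q(2)[of i i] q(4)[of i] by simp
  qed
  ultimately have "barrier_det B S = prod_mset M"
    using True prod_take_rev_sorted_list[of M "card E"]
    by (simp add: barrier_det_def eigenvalues_desc_def)
  also have "\<dots> = (\<Prod>i | q i \<notin> E. lam i)"
    by (simp add: M_def prod_unfold_prod_mset)
  also have "\<dots> = (\<Prod>i\<in>UNIV. if q i \<in> E then 1 else lam i)"
    by (subst prod.mono_neutral_right[of UNIV "{i. q i \<notin> E}"]) auto
  also have "\<dots> = det (S + orth_projection E)"
  proof (rule det_eq_prod_eigenvalues[symmetric, OF q(2)])
    fix i
    show "(S + orth_projection E) *v q i = (if q i \<in> E then 1 else lam i) *\<^sub>R q i"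
      using q(4-6) by (simp add: matrix_vector_mult_add_rdistrib)
  qed
  finally show ?thesis .
qed

section \<open>Covariance and optimality for the log-determinant barrier\<close>

definition covariance :: "(real^'d) pmf \<Rightarrow> real^'d^'d" where
  "covariance p = second_moment p - outer (mean_action p) (mean_action p)"

lemma integrable_pmf_bounded:
  fixes g :: "'a \<Rightarrow> 'b::{banach, second_countable_topology}"
  assumes "\<And>v. v \<in> set_pmf p \<Longrightarrow> norm (g v) \<le> C"
  shows "integrable (measure_pmf p) g"
  using assms by (intro measure_pmf.integrable_const_bound[of _ C]) (auto simp: AE_measure_pmf_iff)

lemma integrable_inner_pmf:
  fixes p :: "(real^'d) pmf"
  assumes "set_pmf p \<subseteq> cball 0 1"
  shows "integrable (measure_pmf p) (\<lambda>v. y \<bullet> v)"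
    "integrable (measure_pmf p) (\<lambda>v. (y \<bullet> v) * (z \<bullet> v))"
proof -
  have y: "\<bar>y \<bullet> v\<bar> \<le> norm y" if "v \<in> set_pmf p" for y v
  proof -
    have "norm v \<le> 1"
      using assms that by auto
    then show ?thesis
      using Cauchy_Schwarz_ineq2[of y v] mult_left_le[of "norm v" "norm y"]
      by (meson norm_ge_zero order_trans)
  qed
  show "integrable (measure_pmf p) (\<lambda>v. y \<bullet> v)"
    using y by (intro integrable_pmf_bounded[where C = "norm y"]) simp
  show "integrable (measure_pmf p) (\<lambda>v. (y \<bullet> v) * (z \<bullet> v))"
    using y by (intro integrable_pmf_bounded[where C = "norm y * norm z"]) (auto simp: abs_mult intro: mult_mono)
qed

lemma inner_mean_action:
  fixes p :: "(real^'d) pmf"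
  assumes "set_pmf p \<subseteq> cball 0 1"
  shows "y \<bullet> mean_action p = measure_pmf.expectation p (\<lambda>v. y \<bullet> v)"
  unfolding mean_action_def
  by (rule integral_inner_right[symmetric]) (use assms in \<open>auto intro!: integrable_pmf_bounded[where C = 1]\<close>)

lemma norm_outer_le: "norm (outer u v) \<le> norm u * norm v"
proof -
  have "norm (outer u v $ i) = \<bar>u $ i\<bar> * norm v" for i
  proof -
    have "outer u v $ i = u $ i *\<^sub>R v"
      by (simp add: outer_def vec_eq_iff)
    then show ?thesis
      by simp
  qed
  then show ?thesis
    by (simp add: norm_vec_def[of "outer u v"] L2_set_right_distrib norm_vec_def[of u] L2_set_left_distrib)
qed

lemma inner_second_moment:
  fixes p :: "(real^'d) pmf"
  assumes "set_pmf p \<subseteq> cball 0 1"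
  shows "y \<bullet> (second_moment p *v z) = measure_pmf.expectation p (\<lambda>v. (y \<bullet> v) * (z \<bullet> v))"
proof -
  have "linear (\<lambda>S :: real^'d^'d. y \<bullet> (S *v z))"
    by (intro linearI)
      (simp_all add: matrix_vector_mult_add_rdistrib inner_add_right flip: scaleR_matrix_vector_assoc)
  then have bl: "bounded_linear (\<lambda>S :: real^'d^'d. y \<bullet> (S *v z))"
    by (simp add: linear_conv_bounded_linear)
  have "integrable (measure_pmf p) (\<lambda>v. outer v v)"
  proof (rule integrable_pmf_bounded[where C = 1])
    fix v assume "v \<in> set_pmf p"
    then show "norm (outer v v) \<le> 1"
      using norm_outer_le[of v v] assms mult_mono[of "norm v" 1 "norm v" 1] by force
  qed
  from integral_bounded_linear[OF bl this] show ?thesis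
    unfolding second_moment_def by (simp add: outer_mult inner_commute mult.commute)
qed

lemma inner_covariance:
  fixes p :: "(real^'d) pmf"
  assumes "set_pmf p \<subseteq> cball 0 1"
  shows "y \<bullet> (covariance p *v z)
    = measure_pmf.expectation p (\<lambda>v. (y \<bullet> v) * (z \<bullet> v)) - (y \<bullet> mean_action p) * (z \<bullet> mean_action p)"
  unfolding covariance_def
  by (simp add: matrix_vector_mult_diff_rdistrib inner_diff_right outer_mult inner_second_moment[OF assms]
      inner_commute mult.commute)

lemma inner_covariance_centered:
  fixes p :: "(real^'d) pmf"
  assumes p: "set_pmf p \<subseteq> cball 0 1"
  shows "y \<bullet> (covariance p *v z)
    = measure_pmf.expectation p (\<lambda>v. (y \<bullet> (v - mean_action p)) * (z \<bullet> (v - mean_action p)))"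
proof -
  let ?m = "mean_action p"
  have "(\<lambda>v. (y \<bullet> (v - ?m)) * (z \<bullet> (v - ?m)))
      = (\<lambda>v. (y \<bullet> v) * (z \<bullet> v) - (z \<bullet> ?m) * (y \<bullet> v) - (y \<bullet> ?m) * (z \<bullet> v) + (y \<bullet> ?m) * (z \<bullet> ?m))"
    by (simp add: fun_eq_iff inner_diff_right algebra_simps)
  moreover have "measure_pmf.expectation p \<dots> = measure_pmf.expectation p (\<lambda>v. (y \<bullet> v) * (z \<bullet> v))
      - (z \<bullet> ?m) * (y \<bullet> ?m) - (y \<bullet> ?m) * (z \<bullet> ?m) + (y \<bullet> ?m) * (z \<bullet> ?m)"
    using integrable_inner_pmf[OF p] by (simp add: inner_mean_action[OF p])
  ultimately show ?thesis
    by (simp add: inner_covariance[OF p] algebra_simps)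
qed

lemma symmetric_covariance:
  fixes p :: "(real^'d) pmf"
  assumes "set_pmf p \<subseteq> cball 0 1"
  shows "transpose (covariance p) = covariance p"
  by (rule symmetric_if_inner) (simp add: inner_covariance[OF assms] mult.commute)

lemma covariance_psd:
  fixes p :: "(real^'d) pmf"
  assumes "set_pmf p \<subseteq> cball 0 1"
  shows "0 \<le> z \<bullet> (covariance p *v z)"
  unfolding inner_covariance_centered[OF assms] by simp

lemma inner_covariance_le:
  fixes p :: "(real^'d) pmf"
  assumes "set_pmf p \<subseteq> cball 0 1"
  shows "z \<bullet> (covariance p *v z) \<le> measure_pmf.expectation p (\<lambda>v. (z \<bullet> v)\<^sup>2)"
  unfolding inner_covariance[OF assms] by (simp add: power2_eq_square)

lemma normal_space_inner_mean:
  fixes p :: "(real^'d) pmf"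
  assumes p: "set_pmf p \<subseteq> cball 0 1" "set_pmf p \<subseteq> B" and n: "n \<in> normal_space B" and b: "b \<in> B"
  shows "n \<bullet> mean_action p = n \<bullet> b"
proof -
  have "n \<bullet> mean_action p = measure_pmf.expectation p (\<lambda>v. n \<bullet> v)"
    by (rule inner_mean_action[OF p(1)])
  also have "\<dots> = measure_pmf.expectation p (\<lambda>v. n \<bullet> b)"
  proof (rule integral_cong_AE)
    show "AE v in measure_pmf p. n \<bullet> v = n \<bullet> b"
    proof (clarsimp simp: AE_measure_pmf_iff)
      fix v assume "v \<in> set_pmf p"
      then have "n \<bullet> (v - b) = 0"
        using n b p(2) unfolding normal_space_def by blast
      then show "n \<bullet> v = n \<bullet> b"
        by (simp add: inner_diff_right)
    qed
  qed auto
  finally show ?thesis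
    by simp
qed

lemma covariance_normal_space:
  fixes p :: "(real^'d) pmf"
  assumes p: "set_pmf p \<subseteq> cball 0 1" "set_pmf p \<subseteq> B" and n: "n \<in> normal_space B"
  shows "covariance p *v n = 0"
proof -
  have "y \<bullet> (covariance p *v n) = 0" for y
  proof -
    have "y \<bullet> (covariance p *v n) = measure_pmf.expectation p (\<lambda>v. 0)"
      unfolding inner_covariance_centered[OF p(1)]
    proof (rule integral_cong_AE)
      show "AE v in measure_pmf p. y \<bullet> (v - mean_action p) * (n \<bullet> (v - mean_action p)) = 0"
        using p(2) normal_space_inner_mean[OF p n] by (auto simp: AE_measure_pmf_iff inner_diff_right)
    qed auto
    then show ?thesis
      by simp
  qed
  then show ?thesis
    by (metis inner_eq_zero_iff)
qed

section \<open>Moving mass of a distribution towards one action\<close>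

definition mix_pmf :: "real \<Rightarrow> 'a \<Rightarrow> 'a pmf \<Rightarrow> 'a pmf" where
  "mix_pmf \<eta> b p = bind_pmf (bernoulli_pmf \<eta>) (\<lambda>c. if c then return_pmf b else p)"

lemma set_mix_pmf: "set_pmf (mix_pmf \<eta> b p) \<subseteq> insert b (set_pmf p)"
  by (auto simp: mix_pmf_def split: if_splits)

lemma expectation_mix_pmf:
  fixes g :: "'a \<Rightarrow> real"
  assumes \<eta>: "0 \<le> \<eta>" "\<eta> \<le> 1" and g: "\<forall>v\<in>insert b (set_pmf p). \<bar>g v\<bar> \<le> C"
  shows "measure_pmf.expectation (mix_pmf \<eta> b p) g
    = \<eta> * g b + (1 - \<eta>) * measure_pmf.expectation p g"
proof -
  \<comment> \<open>\<open>g\<close> is bounded only on the relevant support, while integration over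
    a bind asks for a global bound; \<open>h\<close> agrees with \<open>g\<close> where it
    matters.\<close>
  define h where "h v = (if v \<in> insert b (set_pmf p) then g v else 0)" for v
  have "0 \<le> C"
    using g abs_ge_zero[of "g b"] by (meson insertI1 order_trans)
  then have h: "\<bar>h v\<bar> \<le> C" for v
    using g by (simp add: h_def)
  have cong: "measure_pmf.expectation q g = measure_pmf.expectation q h" if "set_pmf q \<subseteq> insert b (set_pmf p)" for q
    using that by (intro integral_cong_AE) (auto simp: AE_measure_pmf_iff h_def)
  have "measure_pmf.expectation (mix_pmf \<eta> b p) h
      = measure_pmf.expectation (bernoulli_pmf \<eta>) (\<lambda>c. measure_pmf.expectation (if c then return_pmf b else p) h)"
    unfolding mix_pmf_def measure_pmf_bind
    by (rule integral_bind[where B = C and B' = 1 and K = "count_space UNIV"])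
      (auto simp: h measure_pmf.finite_measure_axioms measure_pmf_in_subprob_algebra measure_pmf.emeasure_space_1)
  also have "\<dots> = \<eta> * h b + (1 - \<eta>) * measure_pmf.expectation p h"
    using \<eta> by (simp add: integral_measure_pmf[of UNIV] UNIV_bool)
  finally show ?thesis
    using cong[OF set_mix_pmf] cong[of p] by (simp add: subset_insertI h_def)
qed

text \<open>Law of total variance: the point mass at \<open>b\<close> has no variance of its own, so
  \<open>p\<close> contributes (1 - \<eta>) \<Sigma> and the distance of the two means contributes
  \<eta> (1 - \<eta>) u u^T.\<close>

lemma
  fixes p :: "(real^'d) pmf"
  assumes \<eta>: "0 \<le> \<eta>" "\<eta> \<le> 1" and p: "set_pmf p \<subseteq> cball 0 1" and b: "norm b \<le> 1"
  shows mean_action_mix_pmf: "mean_action (mix_pmf \<eta> b p) = mean_action p + \<eta> *\<^sub>R (b - mean_action p)"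
    and covariance_mix_pmf: "covariance (mix_pmf \<eta> b p)
      = (1 - \<eta>) *\<^sub>R (covariance p + \<eta> *\<^sub>R outer (b - mean_action p) (b - mean_action p))"
proof -
  let ?q = "mix_pmf \<eta> b p" and ?u = "b - mean_action p"
  have q: "set_pmf ?q \<subseteq> cball 0 1"
    using p b set_mix_pmf[of \<eta> b p] by auto
  have y: "\<bar>y \<bullet> v\<bar> \<le> norm y" if "v \<in> insert b (set_pmf p)" for y v
  proof -
    have "norm v \<le> 1"
      using that p b by auto
    then show ?thesis
      using Cauchy_Schwarz_ineq2[of y v] mult_left_le[of "norm v" "norm y"]
      by (meson norm_ge_zero order_trans)
  qed
  have "y \<bullet> mean_action ?q = y \<bullet> (mean_action p + \<eta> *\<^sub>R ?u)" for y
  proof -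
    have "y \<bullet> mean_action ?q = \<eta> * (y \<bullet> b) + (1 - \<eta>) * (y \<bullet> mean_action p)"
      unfolding inner_mean_action[OF q] inner_mean_action[OF p]
      using y by (intro expectation_mix_pmf[OF \<eta>]) blast
    then show ?thesis
      by (simp add: inner_add_right inner_diff_right algebra_simps)
  qed
  then show m: "mean_action ?q = mean_action p + \<eta> *\<^sub>R ?u"
    by (metis vector_eq_ldot)
  show "covariance ?q = (1 - \<eta>) *\<^sub>R (covariance p + \<eta> *\<^sub>R outer ?u ?u)"
  proof (rule matrix_eq_if_inner)
    fix y z
    have "measure_pmf.expectation ?q (\<lambda>v. (y \<bullet> v) * (z \<bullet> v))
        = \<eta> * ((y \<bullet> b) * (z \<bullet> b)) + (1 - \<eta>) * measure_pmf.expectation p (\<lambda>v. (y \<bullet> v) * (z \<bullet> v))"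
      using y by (intro expectation_mix_pmf[OF \<eta>, where C = "norm y * norm z"])
        (auto simp: abs_mult intro!: mult_mono)
    then have l: "y \<bullet> (covariance ?q *v z) = \<eta> * ((y \<bullet> b) * (z \<bullet> b))
        + (1 - \<eta>) * measure_pmf.expectation p (\<lambda>v. (y \<bullet> v) * (z \<bullet> v))
        - (y \<bullet> mean_action p + \<eta> * (y \<bullet> b - y \<bullet> mean_action p)) * (z \<bullet> mean_action p + \<eta> * (z \<bullet> b - z \<bullet> mean_action p))"
      by (simp add: inner_covariance[OF q] m inner_add_right inner_diff_right)
    have r: "y \<bullet> ((1 - \<eta>) *\<^sub>R (covariance p + \<eta> *\<^sub>R outer ?u ?u) *v z)
        = (1 - \<eta>) * (measure_pmf.expectation p (\<lambda>v. (y \<bullet> v) * (z \<bullet> v))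
          - (y \<bullet> mean_action p) * (z \<bullet> mean_action p)
          + \<eta> * ((y \<bullet> b - y \<bullet> mean_action p) * (z \<bullet> b - z \<bullet> mean_action p)))"
      by (simp add: matrix_vector_mult_add_rdistrib inner_add_right outer_mult inner_covariance[OF p]
          flip: scaleR_matrix_vector_assoc)
        (simp add: inner_diff_right inner_diff_left inner_commute algebra_simps)
    show "y \<bullet> (covariance ?q *v z) = y \<bullet> ((1 - \<eta>) *\<^sub>R (covariance p + \<eta> *\<^sub>R outer ?u ?u) *v z)"
      unfolding l r by algebra
  qed
qed

text \<open>Shows that the barrier is finite somewhere, so that a minimiser cannot be degenerate.
  The uniform distribution on an affine basis works: the functional given by a null vector of the
  matrix is constant on the basis, hence on the affine hull, so the vector lies in the span of
  \<open>E\<close>, while the projection term makes it orthogonal to \<open>E\<close>.\<close>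

lemma covariance_plus_projection_det_pos:
  fixes B :: "(real^'d) set"
  assumes B: "B \<noteq> {}" "B \<subseteq> cball 0 1"
    and E: "pairwise orthogonal E" "\<And>e. e \<in> E \<Longrightarrow> norm e = 1" "span E = normal_space B"
  shows "\<exists>p. set_pmf p \<subseteq> B \<and> 0 < det (covariance p + orth_projection E)"
proof -
  obtain C where C: "C \<subseteq> B" "\<not> affine_dependent C" "affine hull B = affine hull C"
    using affine_basis_exists by blast
  have "finite C" "C \<noteq> {}"
    using C(2,3) B aff_independent_finite by (blast, metis affine_hull_eq_empty)
  define p where "p = pmf_of_set C"
  have set_p: "set_pmf p = C"
    unfolding p_def using \<open>finite C\<close> \<open>C \<noteq> {}\<close> by simp
  have p1: "set_pmf p \<subseteq> cball 0 1"
    using set_p C B by auto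
  have finE: "finite E"
    using E orthonormal_independent by blast
  let ?K = "covariance p + orth_projection E"
  have K: "z \<bullet> (?K *v z) = z \<bullet> (covariance p *v z) + (\<Sum>n\<in>E. (n \<bullet> z)\<^sup>2)" for z
    by (simp add: matrix_vector_mult_add_rdistrib inner_add_right orth_projection_mult inner_sum_right
        power2_eq_square inner_commute)
  have "0 < det ?K"
  proof (rule det_pos)
    show "transpose ?K = ?K"
      by (simp add: transpose_add symmetric_covariance[OF p1] symmetric_orth_projection)
    fix z :: "real^'d" assume "z \<noteq> 0"
    show "0 < z \<bullet> (?K *v z)"
    proof (rule ccontr)
      assume "\<not> 0 < z \<bullet> (?K *v z)"
      then have zero: "z \<bullet> (covariance p *v z) = 0" "(\<Sum>n\<in>E. (n \<bullet> z)\<^sup>2) = 0"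
        using covariance_psd[OF p1, of z] sum_nonneg[of E "\<lambda>n. (n \<bullet> z)\<^sup>2"] unfolding K by auto
      let ?m = "mean_action p"
      have "integrable (measure_pmf p) (\<lambda>v. (z \<bullet> (v - ?m)) * (z \<bullet> (v - ?m)))"
        unfolding p_def by (rule integrable_measure_pmf_finite) (simp add: \<open>finite C\<close> \<open>C \<noteq> {}\<close>)
      then have "AE v in measure_pmf p. (z \<bullet> (v - ?m)) * (z \<bullet> (v - ?m)) = 0"
        using zero(1) unfolding inner_covariance_centered[OF p1]
        by (subst (asm) integral_nonneg_eq_0_iff_AE) auto
      then have "C \<subseteq> {v. z \<bullet> v = z \<bullet> ?m}"
        using set_p by (auto simp: AE_measure_pmf_iff inner_diff_right)
      then have "affine hull C \<subseteq> {v. z \<bullet> v = z \<bullet> ?m}"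
        by (intro hull_minimal affine_hyperplane)
      then have "B \<subseteq> {v. z \<bullet> v = z \<bullet> ?m}"
        using C(3) hull_subset[of B affine] by blast
      then have "z \<in> span E"
        unfolding E(3) normal_space_def by (auto simp: inner_diff_right subset_iff)
      then have "(\<Sum>n\<in>E. (z \<bullet> n) *\<^sub>R n) = z"
        using E finE by (intro orthonormal_basis_expand) auto
      moreover have "(\<Sum>n\<in>E. (z \<bullet> n) *\<^sub>R n) = 0"
        using zero(2) finE by (intro sum.neutral) (simp add: sum_nonneg_eq_0_iff inner_commute)
      ultimately show False
        using \<open>z \<noteq> 0\<close> by simp
    qed
  qed
  then show ?thesis
    using set_p C by blast
qed

text \<open>First-order optimality of \<open>p\<close> under moving mass towards \<open>b\<close>; the vector \<open>v\<close> plays the role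
  of \<open>\<Sigma>\<inverse> (b - a\<^sub>p)\<close>, which need not be literally defined since \<open>\<Sigma>\<close> may be singular.\<close>

lemma logdet_barrier_optimality:
  fixes \<theta> :: "real^'d"
  assumes min: "p \<in> logdet_barrier \<theta> \<gamma> B" and \<gamma>: "0 < \<gamma>" and b: "b \<in> B" and B1: "B \<subseteq> cball 0 1"
  shows "\<exists>v. covariance p *v v = b - mean_action p \<and>
    (b - mean_action p) \<bullet> v \<le> real CARD('d) + \<gamma> * ((b - mean_action p) \<bullet> \<theta>)"
proof -
  have "B \<noteq> {}"
    using b by blast
  obtain E where E: "pairwise orthogonal E" "\<And>e. e \<in> E \<Longrightarrow> norm e = 1" "span E = normal_space B"
      "card E = dim (normal_space B)" "E \<subseteq> normal_space B"
    using orthonormal_basis_subspace[OF subspace_normal_space[of B]] by metis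
  have finE: "finite E"
    using E orthonormal_independent by blast
  define k where "k = CARD('d) - card E"
  have cardE: "int (card E) + aff_dim B = int CARD('d)"
    using dim_normal_space[OF \<open>B \<noteq> {}\<close>] E(4) by simp
  define K where "K = covariance p + orth_projection E"
  have pB: "set_pmf p \<subseteq> B" and opt: "\<And>q. set_pmf q \<subseteq> B \<Longrightarrow> logdet_objective \<theta> \<gamma> B p \<le> logdet_objective \<theta> \<gamma> B q"
    using min by (auto simp: logdet_barrier_def is_arg_min_def distributions_on_def not_less)
  have obj: "logdet_objective \<theta> \<gamma> B q = ereal (mean_action q \<bullet> \<theta>)
      - ereal (inverse \<gamma>) * ext_ln (det (covariance q + orth_projection E))" if "set_pmf q \<subseteq> B" for q
  proof -
    have q: "set_pmf q \<subseteq> cball 0 1"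
      using that B1 by blast
    have "barrier_det B (covariance q) = det (covariance q + orth_projection E)"
      by (rule barrier_det_eq_det[OF symmetric_covariance[OF q] covariance_psd[OF q] E(1,2) _ cardE])
        (use E(5) covariance_normal_space[OF q that] in auto)
    then show ?thesis
      by (simp add: logdet_objective_def covariance_def)
  qed
  have p1: "set_pmf p \<subseteq> cball 0 1"
    using pB B1 by blast
  have symK: "transpose K = K"
    by (simp add: K_def transpose_add symmetric_covariance[OF p1] symmetric_orth_projection)
  obtain q where q: "set_pmf q \<subseteq> B" "0 < det (covariance q + orth_projection E)"
    using covariance_plus_projection_det_pos[OF \<open>B \<noteq> {}\<close> B1 E(1-3)] by blast
  \<comment> \<open>Otherwise the objective would be \<infinity> at \<open>p\<close>, and
    \<open>q\<close> would beat it.\<close>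
  have detK: "0 < det K"
  proof (rule ccontr)
    assume "\<not> 0 < det K"
    then have "logdet_objective \<theta> \<gamma> B p = \<infinity>"
      using \<gamma> by (simp add: obj[OF pB] ext_ln_def flip: K_def)
    then show False
      using opt[OF q(1)] q(2) by (simp add: obj[OF q(1)] ext_ln_def)
  qed
  define u where "u = b - mean_action p"
  have "invertible K"
    using detK by (simp add: invertible_det_nz)
  then obtain v where Kv: "K *v v = u"
    by (metis matrix_vector_mul_assoc matrix_vector_mul_lid invertible_def)
  have uE: "e \<bullet> u = 0" if "e \<in> E" for e
    using normal_space_inner_mean[OF p1 pB _ b, of e] E(5) that by (auto simp: u_def inner_diff_right)
  have van: "covariance p *v e = 0" if "e \<in> E" for e
    using covariance_normal_space[OF p1 pB] E(5) that by blast
  \<comment> \<open>The inner product of K v with \<open>e\<close> sees only the projection part of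
    \<open>K\<close>, as \<open>e\<close> is in the kernel of the symmetric covariance. Since u is
    orthogonal to \<open>e\<close>, so is v, and K v = u loses its projection part.\<close>
  have "e \<bullet> v = 0" if "e \<in> E" for e
  proof -
    have "0 = e \<bullet> (covariance p *v v) + e \<bullet> (orth_projection E *v v)"
      using uE[OF that] Kv by (simp add: K_def matrix_vector_mult_add_rdistrib flip: inner_add_right)
    also have "e \<bullet> (covariance p *v v) = 0"
      using symmetric_dot[OF symmetric_covariance[OF p1], of e v] van[OF that] by simp
    also have "e \<bullet> (orth_projection E *v v) = (\<Sum>n\<in>E. if n = e then e \<bullet> v else 0)"
      unfolding orth_projection_mult inner_sum_right using E(1,2) that
      by (intro sum.cong) (auto simp: pairwise_def orthogonal_def norm_eq_1)
    finally show ?thesis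
      using finE that by simp
  qed
  then have cov_v: "covariance p *v v = u"
    using Kv by (simp add: K_def matrix_vector_mult_add_rdistrib orth_projection_mult)
  define w where "w = u \<bullet> v"
  have "0 \<le> w"
    using covariance_psd[OF p1, of v] cov_v by (simp add: w_def inner_commute)
  \<comment> \<open>Optimality against the mixture at a fixed \<eta>, already divided by \<eta>; the
    limit at 0 is taken afterwards. The exponent \<open>k\<close> counts the directions inside the
    affine hull, the only ones scaled by 1 - \<eta>.\<close>
  have step: "w / (1 + \<eta> * w) - real k / (1 - \<eta>) \<le> \<gamma> * (u \<bullet> \<theta>)" if \<eta>: "0 < \<eta>" "\<eta> < 1" for \<eta>
  proof -
    let ?q = "mix_pmf \<eta> b p"
    have qB: "set_pmf ?q \<subseteq> B"
      using pB b set_mix_pmf[of \<eta> b p] by blast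
    have b1: "norm b \<le> 1"
      using b B1 by auto
    have \<eta>': "0 \<le> \<eta>" "\<eta> \<le> 1"
      using \<eta> by auto
    let ?S = "covariance p + \<eta> *\<^sub>R outer u u"
    have "transpose ?S = ?S"
      by (rule symmetric_if_inner)
        (simp add: matrix_vector_mult_add_rdistrib inner_add_right outer_mult inner_commute
          inner_covariance[OF p1] mult_ac flip: scaleR_matrix_vector_assoc)
    moreover have "?S *v e = 0" if "e \<in> E" for e
      using van[OF that] uE[OF that]
      by (simp add: matrix_vector_mult_add_rdistrib outer_mult inner_commute flip: scaleR_matrix_vector_assoc)
    ultimately have "det (covariance ?q + orth_projection E) = (1 - \<eta>) ^ k * det (?S + orth_projection E)"
      unfolding covariance_mix_pmf[OF \<eta>' p1 b1] k_def u_def[symmetric]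
      using det_scaled_plus_projection[of ?S E "1 - \<eta>"] E(1,2) by blast
    also have "?S + orth_projection E = K + outer (sqrt \<eta> *\<^sub>R u) (sqrt \<eta> *\<^sub>R u)"
      using \<eta> by (simp add: K_def outer_def vec_eq_iff)
    also have "det \<dots> = (1 + \<eta> * w) * det K"
      using det_rank_one_update[OF symK, of "sqrt \<eta> *\<^sub>R v" "sqrt \<eta> *\<^sub>R u"] \<eta> Kv
      by (simp add: matrix_vector_mult_scaleR w_def)
    finally have det_q: "det (covariance ?q + orth_projection E) = (1 - \<eta>) ^ k * ((1 + \<eta> * w) * det K)" .
    have pos: "0 < 1 + \<eta> * w"
      using \<open>0 \<le> w\<close> \<eta> by (simp add: add_pos_nonneg)
    have "logdet_objective \<theta> \<gamma> B p \<le> logdet_objective \<theta> \<gamma> B ?q"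
      by (rule opt[OF qB])
    then have "mean_action p \<bullet> \<theta> - inverse \<gamma> * ln (det K)
        \<le> mean_action ?q \<bullet> \<theta> - inverse \<gamma> * ln ((1 - \<eta>) ^ k * ((1 + \<eta> * w) * det K))"
      unfolding obj[OF pB] obj[OF qB] K_def[symmetric] det_q using detK pos \<eta> by (simp add: ext_ln_def)
    moreover have "ln ((1 - \<eta>) ^ k * ((1 + \<eta> * w) * det K)) = real k * ln (1 - \<eta>) + ln (1 + \<eta> * w) + ln (det K)"
      using detK pos \<eta> by (simp add: ln_mult ln_realpow)
    ultimately have "inverse \<gamma> * (real k * ln (1 - \<eta>) + ln (1 + \<eta> * w)) \<le> \<eta> * (u \<bullet> \<theta>)"
      by (simp add: mean_action_mix_pmf[OF \<eta>' p1 b1] u_def inner_add_left inner_diff_left algebra_simps)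
    then have "real k * ln (1 - \<eta>) + ln (1 + \<eta> * w) \<le> \<gamma> * (\<eta> * (u \<bullet> \<theta>))"
      using \<gamma> by (simp add: field_simps)
    \<comment> \<open>Applied to 1 - \<eta> and 1 + \<eta> w, this replaces both logarithms by
      rational lower bounds with a factor \<eta> that cancels, so the determinant is never
      differentiated.\<close>
    moreover have ln_ge: "1 - 1 / z \<le> ln z" if "0 < z" for z :: real
      using ln_le_minus_one[of "1 / z"] that by (simp add: ln_div)
    have "- \<eta> / (1 - \<eta>) \<le> ln (1 - \<eta>)" "\<eta> * w / (1 + \<eta> * w) \<le> ln (1 + \<eta> * w)"
      using ln_ge[of "1 - \<eta>"] ln_ge[of "1 + \<eta> * w"] \<eta> pos by (auto simp: field_simps)
    then have "real k * (- \<eta> / (1 - \<eta>)) + \<eta> * w / (1 + \<eta> * w) \<le> real k * ln (1 - \<eta>) + ln (1 + \<eta> * w)"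
      by (intro add_mono mult_left_mono) auto
    ultimately have "real k * (- \<eta> / (1 - \<eta>)) + \<eta> * w / (1 + \<eta> * w) \<le> \<gamma> * (\<eta> * (u \<bullet> \<theta>))"
      by linarith
    also have "real k * (- \<eta> / (1 - \<eta>)) + \<eta> * w / (1 + \<eta> * w) = \<eta> * (w / (1 + \<eta> * w) - real k / (1 - \<eta>))"
      by (simp add: algebra_simps)
    finally show ?thesis
      using \<eta> by (simp add: mult.left_commute[of \<gamma>])
  qed
  have "((\<lambda>\<eta>. w / (1 + \<eta> * w) - real k / (1 - \<eta>)) \<longlongrightarrow> w / (1 + 0 * w) - real k / (1 - 0)) (at_right 0)"
    by (intro tendsto_intros) auto
  moreover have "eventually (\<lambda>\<eta>. w / (1 + \<eta> * w) - real k / (1 - \<eta>) \<le> \<gamma> * (u \<bullet> \<theta>)) (at_right 0)"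
    unfolding eventually_at_right_field using step by (intro exI[of _ 1]) auto
  ultimately have "w - real k \<le> \<gamma> * (u \<bullet> \<theta>)"
    using tendsto_upperbound[where F = "at_right (0::real)"] by fastforce
  moreover have "real k \<le> real CARD('d)"
    by (simp add: k_def)
  ultimately have "w \<le> real CARD('d) + \<gamma> * (u \<bullet> \<theta>)"
    by linarith
  then show ?thesis
    using cov_v by (auto simp: u_def w_def)
qed

lemma logdet_barrier_regret:
  fixes \<theta> f :: "real^'d"
  assumes min: "p \<in> logdet_barrier \<theta> \<gamma> B" and \<gamma>: "0 < \<gamma>" and b: "b \<in> B" and B1: "B \<subseteq> cball 0 1"
  shows "(mean_action p - b) \<bullet> f
    \<le> real CARD('d) / \<gamma> + \<gamma> / 4 * measure_pmf.expectation p (\<lambda>v. (v \<bullet> (\<theta> - f))\<^sup>2)"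
proof -
  define u where "u = b - mean_action p"
  define z where "z = \<theta> - f"
  obtain v where v: "covariance p *v v = u" "u \<bullet> v \<le> real CARD('d) + \<gamma> * (u \<bullet> \<theta>)"
    using logdet_barrier_optimality[OF assms] unfolding u_def by blast
  have p1: "set_pmf p \<subseteq> cball 0 1"
    using min B1 by (auto simp: logdet_barrier_def is_arg_min_def distributions_on_def)
  let ?C = "covariance p"
  \<comment> \<open>Nonnegativity of the covariance form at this vector does Cauchy--Schwarz and
    AM-GM in one stroke and produces the factor \<gamma> / 4. The term \<gamma> (u \<bullet>
    \<theta>) from optimality cancels against the one in \<gamma> (u \<bullet> z), which leaves only
    f.\<close>
  have "0 \<le> (v - (\<gamma> / 2) *\<^sub>R z) \<bullet> (?C *v (v - (\<gamma> / 2) *\<^sub>R z))"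
    by (rule covariance_psd[OF p1])
  also have "\<dots> = v \<bullet> u - \<gamma> * (u \<bullet> z) + \<gamma>\<^sup>2 / 4 * (z \<bullet> (?C *v z))"
    using symmetric_dot[OF symmetric_covariance[OF p1], of v z] v(1)
    by (simp add: matrix_vector_mult_diff_distrib matrix_vector_mult_scaleR inner_diff_left inner_diff_right
        inner_commute power2_eq_square algebra_simps)
  finally have "\<gamma> * (u \<bullet> z) \<le> real CARD('d) + \<gamma> * (u \<bullet> \<theta>) + \<gamma>\<^sup>2 / 4 * (z \<bullet> (?C *v z))"
    using v(2) by (simp add: inner_commute)
  also have "\<dots> \<le> real CARD('d) + \<gamma> * (u \<bullet> \<theta>) + \<gamma>\<^sup>2 / 4 * measure_pmf.expectation p (\<lambda>v. (z \<bullet> v)\<^sup>2)"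
    using inner_covariance_le[OF p1, of z] by (intro add_left_mono mult_left_mono) auto
  finally have "u \<bullet> z \<le> (real CARD('d) + \<gamma> * (u \<bullet> \<theta>) + \<gamma>\<^sup>2 / 4 * measure_pmf.expectation p (\<lambda>v. (z \<bullet> v)\<^sup>2)) / \<gamma>"
    using \<gamma> by (simp add: pos_le_divide_eq mult.commute)
  also have "\<dots> = real CARD('d) / \<gamma> + u \<bullet> \<theta> + \<gamma> / 4 * measure_pmf.expectation p (\<lambda>v. (z \<bullet> v)\<^sup>2)"
    using \<gamma> by (simp add: add_divide_distrib power2_eq_square)
  finally show ?thesis
    by (simp add: z_def u_def inner_diff_left inner_diff_right inner_commute)
qed

text \<open>As \<open>inverse 0 = 0\<close> and 0 times an infinity is 0 in the extended reals, the
  objective is linear, and the point mass at \<open>b\<close> is a finite competitor although its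
  covariance vanishes.\<close>

lemma logdet_barrier_zero_greedy:
  assumes "p \<in> logdet_barrier \<theta> 0 B" "b \<in> B"
  shows "mean_action p \<bullet> \<theta> \<le> b \<bullet> \<theta>"
proof -
  have "logdet_objective \<theta> 0 B p \<le> logdet_objective \<theta> 0 B (return_pmf b)"
    using assms by (auto simp: logdet_barrier_def is_arg_min_def distributions_on_def not_less)
  moreover have "mean_action (return_pmf b) = b"
    by (simp add: mean_action_def)
  ultimately show ?thesis
    by (simp add: logdet_objective_def flip: zero_ereal_def)
qed

section \<open>Conditional distribution of the actions\<close>

context prob_space
begin

text \<open>Conditional expectations enter the argument only in this weak form, tested against
  bounded \<open>G\<close>-measurable factors; \<open>h\<close> is whichever version the hypotheses
  supply.\<close>

lemma real_cond_exp_test: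
  assumes sub: "subalgebra M G" and Z: "Z \<in> borel_measurable G" "\<And>\<omega>. \<omega> \<in> space M \<Longrightarrow> \<bar>Z \<omega>\<bar> \<le> C"
    and g: "g \<in> borel_measurable M" "\<And>\<omega>. \<omega> \<in> space M \<Longrightarrow> \<bar>g \<omega>\<bar> \<le> (D :: real)"
    and h: "h \<in> borel_measurable M" "AE \<omega> in M. real_cond_exp M G g \<omega> = h \<omega>"
  shows "expectation (\<lambda>\<omega>. Z \<omega> * g \<omega>) = expectation (\<lambda>\<omega>. Z \<omega> * h \<omega>)"
proof -
  interpret G: sigma_finite_subalgebra M G
    using sub by (intro finite_measure_subalgebra_is_sigma_finite finite_measure_subalgebra.intro
        finite_measure_subalgebra_axioms.intro finite_measure_axioms)
  have ZM: "Z \<in> borel_measurable M"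
    using Z(1) sub by (rule measurable_from_subalg[rotated])
  have "integrable M (\<lambda>\<omega>. Z \<omega> * g \<omega>)"
    using Z(2) g(2) ZM g(1)
    by (intro integrable_const_bound[of _ "C * D"]) (auto simp: abs_mult intro!: AE_I2 mult_mono'
        intro: order_trans[OF abs_ge_zero])
  from G.real_cond_exp_intg(2)[OF this Z(1) g(1)]
  have "expectation (\<lambda>\<omega>. Z \<omega> * g \<omega>) = expectation (\<lambda>\<omega>. Z \<omega> * real_cond_exp M G g \<omega>)"
    by simp
  also have "\<dots> = expectation (\<lambda>\<omega>. Z \<omega> * h \<omega>)"
    using h ZM by (intro integral_cong_AE) auto
  finally show ?thesis .
qed

text \<open>The conditional law of \<open>Y\<close> is given on Borel sets only. To integrate a
  function against it, it is read as a Markov kernel: after weighting \<open>M\<close> by a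
  nonnegative \<open>Z\<close>, the law of \<open>Y\<close> and the average of the kernel agree on
  Borel sets, hence are the same measure and integrate \<open>g\<close> alike.\<close>

lemma
  fixes Y :: "'a \<Rightarrow> 'v::topological_space" and p :: "'a \<Rightarrow> 'v pmf" and g :: "'v \<Rightarrow> real"
  assumes sub: "subalgebra M G" and Y: "Y \<in> borel_measurable M"
    and p_meas: "\<And>B. B \<in> sets borel \<Longrightarrow> (\<lambda>\<omega>. measure_pmf.prob (p \<omega>) B) \<in> borel_measurable G"
    and p_cond: "\<And>B. B \<in> sets borel \<Longrightarrow>
      AE \<omega> in M. real_cond_exp M G (\<lambda>\<omega>. indicator B (Y \<omega>)) \<omega> = measure_pmf.prob (p \<omega>) B"
    and g: "g \<in> borel_measurable borel" "\<And>v. \<bar>g v\<bar> \<le> D"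
  shows borel_measurable_pmf_kernel: "(\<lambda>\<omega>. measure_pmf.expectation (p \<omega>) g) \<in> borel_measurable G"
    and expectation_pmf_kernel: "Z \<in> borel_measurable G \<Longrightarrow> (\<And>\<omega>. \<omega> \<in> space M \<Longrightarrow> \<bar>Z \<omega>\<bar> \<le> C) \<Longrightarrow>
      expectation (\<lambda>\<omega>. Z \<omega> * g (Y \<omega>)) = expectation (\<lambda>\<omega>. Z \<omega> * measure_pmf.expectation (p \<omega>) g)"
proof -
  \<comment> \<open>The measure of a pmf lives on all subsets. Its restriction to Borel sets is a
    measurable map into \<open>subprob_algebra borel\<close>, for which measurability of the Borel
    probabilities suffices.\<close>
  define \<kappa> where "\<kappa> \<omega> = distr (measure_pmf (p \<omega>)) borel (\<lambda>v. v)" for \<omega>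
  have prob_\<kappa>: "prob_space (\<kappa> \<omega>)" for \<omega>
    unfolding \<kappa>_def by (intro measure_pmf.prob_space_distr) simp
  have sets_\<kappa>: "sets (\<kappa> \<omega>) = sets borel" for \<omega>
    by (simp add: \<kappa>_def)
  have em_\<kappa>: "emeasure (\<kappa> \<omega>) B = ennreal (measure_pmf.prob (p \<omega>) B)" if "B \<in> sets borel" for \<omega> B
    using that by (simp add: \<kappa>_def emeasure_distr measure_pmf.emeasure_eq_measure)
  have \<kappa>_meas: "\<kappa> \<in> measurable G (subprob_algebra borel)"
    by (rule measurable_subprob_algebra)
      (auto simp: prob_\<kappa> prob_space_imp_subprob_space sets_\<kappa> em_\<kappa> p_meas)
  then have \<kappa>_M: "\<kappa> \<in> measurable M (subprob_algebra borel)"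
    by (rule measurable_from_subalg[OF sub])
  have int_\<kappa>: "integral\<^sup>L (\<kappa> \<omega>) g = measure_pmf.expectation (p \<omega>) g" for \<omega>
    unfolding \<kappa>_def using g by (subst integral_distr) auto
  show meas: "(\<lambda>\<omega>. measure_pmf.expectation (p \<omega>) g) \<in> borel_measurable G"
    unfolding int_\<kappa>[symmetric]
    by (rule measurable_compose[OF \<kappa>_meas integral_measurable_subprob_algebra[OF g(1)]])
  have meas_M: "(\<lambda>\<omega>. measure_pmf.expectation (p \<omega>) g) \<in> borel_measurable M"
    using measurable_from_subalg[OF sub meas] .
  have "0 \<le> D"
    using order_trans[OF abs_ge_zero g(2)] .
  have E_le: "\<bar>measure_pmf.expectation (p \<omega>) g\<bar> \<le> D" for \<omega>
  proof -
    have "\<bar>measure_pmf.expectation (p \<omega>) g\<bar> \<le> measure_pmf.expectation (p \<omega>) (\<lambda>v. \<bar>g v\<bar>)"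
      by (rule integral_abs_bound)
    also have "\<dots> \<le> measure_pmf.expectation (p \<omega>) (\<lambda>v. D)"
      using g(2) \<open>0 \<le> D\<close> by (intro integral_mono measure_pmf.integrable_const_bound[of _ D]) auto
    finally show ?thesis
      by simp
  qed
  have nonneg: "expectation (\<lambda>\<omega>. Z \<omega> * g (Y \<omega>)) = expectation (\<lambda>\<omega>. Z \<omega> * measure_pmf.expectation (p \<omega>) g)"
    if Z: "Z \<in> borel_measurable G" "\<And>\<omega>. \<omega> \<in> space M \<Longrightarrow> 0 \<le> Z \<omega> \<and> Z \<omega> \<le> C" for Z C
  proof -
    have ZM: "Z \<in> borel_measurable M"
      using measurable_from_subalg[OF sub Z(1)] .
    have "0 \<le> C"
      using Z(2) not_empty by (meson all_not_in_conv order_trans)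
    define N where "N = density M (\<lambda>\<omega>. ennreal (Z \<omega>))"
    have intZ: "integrable M Z"
      using Z(2) ZM by (intro integrable_const_bound[of _ C]) (auto intro!: AE_I2)
    have finN: "finite_measure N"
    proof (rule finite_measureI)
      have "emeasure N (space N) = (\<integral>\<^sup>+ \<omega>. ennreal (Z \<omega>) \<partial>M)"
        unfolding N_def using ZM by (auto simp: emeasure_density intro!: nn_integral_cong)
      also have "\<dots> < \<infinity>"
        using intZ Z(2) by (subst nn_integral_eq_integral) (auto intro!: AE_I2)
      finally show "emeasure N (space N) \<noteq> \<infinity>"
        by simp
    qed
    have YN: "Y \<in> measurable N borel" and \<kappa>N: "\<kappa> \<in> measurable N (subprob_algebra borel)"
      using Y \<kappa>_M by (simp_all add: N_def)
    have "distr N borel Y = N \<bind> \<kappa>"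
    proof (rule measure_eqI)
      show "sets (distr N borel Y) = sets (N \<bind> \<kappa>)"
        using sets_\<kappa> not_empty by (subst sets_bind[where N = borel]) (auto simp: N_def)
      fix B assume "B \<in> sets (distr N borel Y)"
      then have B[measurable]: "B \<in> sets borel"
        by simp
      have "(\<lambda>\<omega>. indicator B (Y \<omega>) :: real) \<in> borel_measurable M"
        using Y by simp
      then have ex: "expectation (\<lambda>\<omega>. Z \<omega> * indicator B (Y \<omega>)) = expectation (\<lambda>\<omega>. Z \<omega> * measure_pmf.prob (p \<omega>) B)"
        using Z p_cond[OF B] measurable_from_subalg[OF sub p_meas[OF B]]
        by (intro real_cond_exp_test[OF sub, of _ C _ 1]) (auto simp: indicator_def)
      have "emeasure (distr N borel Y) B = (\<integral>\<^sup>+ \<omega>. ennreal (Z \<omega> * indicator B (Y \<omega>)) \<partial>M)"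
        using YN B Y ZM by (auto simp: emeasure_distr N_def emeasure_density indicator_def intro!: nn_integral_cong)
      also have "\<dots> = ennreal (expectation (\<lambda>\<omega>. Z \<omega> * indicator B (Y \<omega>)))"
        using Z(2) ZM Y B \<open>0 \<le> C\<close>
        by (intro nn_integral_eq_integral integrable_const_bound[of _ C]) (auto simp: indicator_def intro!: AE_I2)
      also have "\<dots> = (\<integral>\<^sup>+ \<omega>. ennreal (Z \<omega> * measure_pmf.prob (p \<omega>) B) \<partial>M)"
        unfolding ex
      proof (rule nn_integral_eq_integral[symmetric])
        show "integrable M (\<lambda>\<omega>. Z \<omega> * measure_pmf.prob (p \<omega>) B)"
        proof (rule integrable_const_bound[of _ C])
          have "Z \<omega> * measure_pmf.prob (p \<omega>) B \<le> C" if "\<omega> \<in> space M" for \<omega>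
            using Z(2)[OF that] mult_mono[of "Z \<omega>" C "measure_pmf.prob (p \<omega>) B" 1] \<open>0 \<le> C\<close> by simp
          then show "AE \<omega> in M. norm (Z \<omega> * measure_pmf.prob (p \<omega>) B) \<le> C"
            using Z(2) by (intro AE_I2) simp
        qed (use ZM measurable_from_subalg[OF sub p_meas[OF B]] in simp)
      qed (use Z(2) in \<open>auto intro!: AE_I2\<close>)
      also have "\<dots> = (\<integral>\<^sup>+ \<omega>. ennreal (Z \<omega>) * emeasure (\<kappa> \<omega>) B \<partial>M)"
        using Z(2) by (intro nn_integral_cong) (simp add: em_\<kappa>[OF B] ennreal_mult)
      also have "\<dots> = (\<integral>\<^sup>+ \<omega>. emeasure (\<kappa> \<omega>) B \<partial>N)"
        unfolding N_def using ZM measurable_compose[OF \<kappa>_M measurable_emeasure_subprob_algebra[OF B]] by (subst nn_integral_density) auto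
      also have "\<dots> = emeasure (N \<bind> \<kappa>) B"
        using \<kappa>N B not_empty by (subst emeasure_bind[where N = borel]) (auto simp: N_def)
      finally show "emeasure (distr N borel Y) B = emeasure (N \<bind> \<kappa>) B" .
    qed
    then have "integral\<^sup>L (distr N borel Y) g = integral\<^sup>L (N \<bind> \<kappa>) g"
      by simp
    moreover have "integral\<^sup>L (distr N borel Y) g = expectation (\<lambda>\<omega>. Z \<omega> * g (Y \<omega>))"
    proof -
      have "integral\<^sup>L (distr N borel Y) g = integral\<^sup>L N (\<lambda>\<omega>. g (Y \<omega>))"
        using YN g by (simp add: integral_distr)
      also have "\<dots> = expectation (\<lambda>\<omega>. Z \<omega> *\<^sub>R g (Y \<omega>))"
        unfolding N_def using ZM Y g Z(2) by (intro integral_density) (auto intro!: AE_I2)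
      finally show ?thesis
        by simp
    qed
    moreover have "integral\<^sup>L (N \<bind> \<kappa>) g = expectation (\<lambda>\<omega>. Z \<omega> * measure_pmf.expectation (p \<omega>) g)"
    proof -
      have "integral\<^sup>L (N \<bind> \<kappa>) g = integral\<^sup>L N (\<lambda>\<omega>. integral\<^sup>L (\<kappa> \<omega>) g)"
        using g \<kappa>N finN prob_\<kappa>
        by (intro integral_bind[where B = D and B' = 1 and K = borel])
          (auto simp: prob_space.emeasure_space_1)
      also have "\<dots> = expectation (\<lambda>\<omega>. Z \<omega> *\<^sub>R measure_pmf.expectation (p \<omega>) g)"
        unfolding N_def int_\<kappa> using ZM meas_M Z(2) by (intro integral_density) (auto intro!: AE_I2)
      finally show ?thesis
        by simp
    qed
    ultimately show ?thesis
      by simp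
  qed
  assume Z: "Z \<in> borel_measurable G" "\<And>\<omega>. \<omega> \<in> space M \<Longrightarrow> \<bar>Z \<omega>\<bar> \<le> C"
  have ZM: "Z \<in> borel_measurable M"
    using measurable_from_subalg[OF sub Z(1)] .
  have "0 \<le> C"
    using Z(2) not_empty by (metis abs_ge_zero all_not_in_conv order_trans)
  have int: "integrable M (\<lambda>\<omega>. Z \<omega> * h \<omega>)" "integrable M h"
    if "h \<in> borel_measurable M" "\<And>\<omega>. \<bar>h \<omega>\<bar> \<le> D" for h
  proof -
    show "integrable M h"
      using that by (intro integrable_const_bound[of _ D]) auto
    show "integrable M (\<lambda>\<omega>. Z \<omega> * h \<omega>)"
      using that ZM Z(2) \<open>0 \<le> C\<close>
      by (intro integrable_const_bound[of _ "C * D"]) (auto simp: abs_mult intro!: AE_I2 mult_mono)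
  qed
  have gY: "(\<lambda>\<omega>. g (Y \<omega>)) \<in> borel_measurable M"
    using g Y by simp
  \<comment> \<open>A signed \<open>Z\<close> is shifted into [0, 2 C] so that it can serve as a
    density; the identity also holds for the constant \<open>C\<close>, and linearity removes the
    shift.\<close>
  have "expectation (\<lambda>\<omega>. (Z \<omega> + C) * g (Y \<omega>)) = expectation (\<lambda>\<omega>. (Z \<omega> + C) * measure_pmf.expectation (p \<omega>) g)"
    using Z by (intro nonneg[of _ "2 * C"]) (auto simp: abs_le_iff dest!: Z(2))
  moreover have "expectation (\<lambda>\<omega>. C * g (Y \<omega>)) = expectation (\<lambda>\<omega>. C * measure_pmf.expectation (p \<omega>) g)"
    using \<open>0 \<le> C\<close> by (intro nonneg[of _ C]) auto
  moreover have "expectation (\<lambda>\<omega>. (Z \<omega> + C) * h \<omega>) = expectation (\<lambda>\<omega>. Z \<omega> * h \<omega>) + expectation (\<lambda>\<omega>. C * h \<omega>)"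
    if "h \<in> borel_measurable M" "\<And>\<omega>. \<bar>h \<omega>\<bar> \<le> D" for h
    using int[OF that] by (simp add: distrib_right)
  ultimately show "expectation (\<lambda>\<omega>. Z \<omega> * g (Y \<omega>)) = expectation (\<lambda>\<omega>. Z \<omega> * measure_pmf.expectation (p \<omega>) g)"
    using gY meas_M g(2) E_le by (simp, elim disjE) auto
qed

end

section \<open>Regret of SquareCB.Lin\<close>

definition bounded_rv :: "'w measure \<Rightarrow> ('w \<Rightarrow> real) \<Rightarrow> bool" where
  "bounded_rv M f \<longleftrightarrow> f \<in> borel_measurable M \<and> (\<exists>C. \<forall>\<omega>\<in>space M. \<bar>f \<omega>\<bar> \<le> C)"

lemma bounded_rvI: "f \<in> borel_measurable M \<Longrightarrow> (\<And>\<omega>. \<omega> \<in> space M \<Longrightarrow> \<bar>f \<omega>\<bar> \<le> C) \<Longrightarrow> bounded_rv M f"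
  by (auto simp: bounded_rv_def)

lemma bounded_rv_const [intro]: "bounded_rv M (\<lambda>_. c)"
  by (rule bounded_rvI[of _ _ "\<bar>c\<bar>"]) auto

lemma bounded_rv_add [intro]:
  assumes "bounded_rv M f" "bounded_rv M g"
  shows "bounded_rv M (\<lambda>\<omega>. f \<omega> + g \<omega>)"
proof -
  obtain C D where "\<forall>\<omega>\<in>space M. \<bar>f \<omega>\<bar> \<le> C" "\<forall>\<omega>\<in>space M. \<bar>g \<omega>\<bar> \<le> D"
    using assms by (auto simp: bounded_rv_def)
  then have "\<bar>f \<omega> + g \<omega>\<bar> \<le> C + D" if "\<omega> \<in> space M" for \<omega>
    using that by fastforce
  then show ?thesis
    using assms by (auto simp: bounded_rv_def)
qed

lemma bounded_rv_mult [intro]: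
  assumes "bounded_rv M f" "bounded_rv M g"
  shows "bounded_rv M (\<lambda>\<omega>. f \<omega> * g \<omega>)"
proof -
  obtain C D where "\<forall>\<omega>\<in>space M. \<bar>f \<omega>\<bar> \<le> C" "\<forall>\<omega>\<in>space M. \<bar>g \<omega>\<bar> \<le> D"
    using assms by (auto simp: bounded_rv_def)
  then have "\<bar>f \<omega> * g \<omega>\<bar> \<le> C * D" if "\<omega> \<in> space M" for \<omega>
    using that unfolding abs_mult by (intro mult_mono) force+
  then show ?thesis
    using assms by (auto simp: bounded_rv_def)
qed

lemma bounded_rv_diff [intro]: "bounded_rv M f \<Longrightarrow> bounded_rv M g \<Longrightarrow> bounded_rv M (\<lambda>\<omega>. f \<omega> - g \<omega>)"
  using bounded_rv_add[of M f "\<lambda>\<omega>. (- 1) * g \<omega>"] bounded_rv_mult[of M "\<lambda>_. - 1" g] by auto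

lemma bounded_rv_power2 [intro]: "bounded_rv M f \<Longrightarrow> bounded_rv M (\<lambda>\<omega>. (f \<omega>)\<^sup>2)"
  unfolding power2_eq_square by blast

lemma bounded_rv_sum [intro]: "(\<And>i. i \<in> I \<Longrightarrow> bounded_rv M (f i)) \<Longrightarrow> bounded_rv M (\<lambda>\<omega>. \<Sum>i\<in>I. f i \<omega>)"
  by (induction I rule: infinite_finite_induct) auto

lemma bounded_rv_inner:
  fixes f g :: "'w \<Rightarrow> real^'d"
  assumes "\<And>i. bounded_rv M (\<lambda>\<omega>. f \<omega> $ i)" "\<And>i. bounded_rv M (\<lambda>\<omega>. g \<omega> $ i)"
  shows "bounded_rv M (\<lambda>\<omega>. f \<omega> \<bullet> g \<omega>)"
  unfolding inner_vec_def inner_real_def by (intro bounded_rv_sum bounded_rv_mult assms)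

lemma bounded_rv_component:
  fixes f :: "'w \<Rightarrow> real^'d"
  assumes "f \<in> borel_measurable M" "\<And>\<omega>. \<omega> \<in> space M \<Longrightarrow> norm (f \<omega>) \<le> C"
  shows "bounded_rv M (\<lambda>\<omega>. f \<omega> $ i)"
proof (rule bounded_rvI)
  show "(\<lambda>\<omega>. f \<omega> $ i) \<in> borel_measurable M"
    by (rule measurable_compose[OF assms(1)]) (intro borel_measurable_continuous_onI continuous_intros)
  show "\<bar>f \<omega> $ i\<bar> \<le> C" if "\<omega> \<in> space M" for \<omega>
    using assms(2)[OF that] component_le_norm_cart[of "f \<omega>" i] by linarith
qed

lemma bounded_rv_cong:
  "bounded_rv M f \<Longrightarrow> (\<And>\<omega>. \<omega> \<in> space M \<Longrightarrow> f \<omega> = g \<omega>) \<Longrightarrow> bounded_rv M g"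
  using measurable_cong[of M f g borel] by (auto simp: bounded_rv_def)

text \<open>The predicate sees only the space and the sets of a measure, not its probabilities, so a
  bounded variable of the past is one of \<open>M\<close>.\<close>

lemma bounded_rv_subalgebra: "subalgebra M G \<Longrightarrow> bounded_rv G f \<Longrightarrow> bounded_rv M f"
  by (auto simp: bounded_rv_def subalgebra_def intro: measurable_from_subalg[unfolded subalgebra_def])

lemma (in finite_measure) bounded_rv_integrable [intro]: "bounded_rv M f \<Longrightarrow> integrable M f"
  unfolding bounded_rv_def by (auto intro!: integrable_const_bound AE_I2)

text \<open>Jensen's inequality for the square, read off from the nonnegative variance.\<close>

lemma (in prob_space) expectation_le_sqrt:
  assumes "bounded_rv M f" "expectation (\<lambda>\<omega>. (f \<omega>)\<^sup>2) \<le> \<delta>"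
  shows "\<bar>expectation f\<bar> \<le> sqrt \<delta>"
proof -
  have "0 \<le> expectation (\<lambda>\<omega>. (f \<omega> - expectation f)\<^sup>2)"
    by simp
  also have "\<dots> = expectation (\<lambda>\<omega>. (f \<omega>)\<^sup>2) - (expectation f)\<^sup>2"
    using assms(1) by (intro variance_eq) auto
  finally show ?thesis
    using assms(2) by (simp add: real_le_rsqrt real_le_lsqrt abs_le_square_iff[symmetric] flip: real_sqrt_abs)
qed

text \<open>The witnesses \<open>\<theta>\<close> and \<open>p\<close> of
  \<open>squarecb_lin\<close> become parameters, and \<open>\<gamma>\<close> stays arbitrary, so
  that positive and zero learning rates share all facts about predictions and sampling.\<close>

locale squarecb_run = contextual_bandit M X T x A \<mu> H a l
  for M :: "'w measure" and X :: "'x set" and T x and A :: "nat \<Rightarrow> (real^'d) set"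
    and \<mu> H a l +
  fixes F :: "('x \<Rightarrow> real^'d) set" and orc :: "('x, 'd) regression_oracle" and R \<gamma> :: real
    and \<theta> :: "nat \<Rightarrow> 'w \<Rightarrow> real^'d" and p :: "nat \<Rightarrow> 'w \<Rightarrow> (real^'d) pmf"
  assumes F_nonempty: "F \<noteq> {}"
    and regression_regret: "square_loss_oracle orc X F T R"
    and \<theta>_eq: "t \<in> {1..T} \<Longrightarrow> \<omega> \<in> space M \<Longrightarrow>
      \<theta> t \<omega> = oracle_prediction orc x (\<lambda>s. a s \<omega>) (\<lambda>s. l s \<omega>) t"
    and \<theta>_meas: "t \<in> {1..T} \<Longrightarrow> \<theta> t \<in> borel_measurable (H t)"
    and p_barrier: "t \<in> {1..T} \<Longrightarrow> \<omega> \<in> space M \<Longrightarrow> p t \<omega> \<in> logdet_barrier (\<theta> t \<omega>) \<gamma> (A t)"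
    and p_meas: "t \<in> {1..T} \<Longrightarrow> B \<in> sets borel \<Longrightarrow>
      (\<lambda>\<omega>. measure_pmf.prob (p t \<omega>) B) \<in> borel_measurable (H t)"
    and p_cond: "t \<in> {1..T} \<Longrightarrow> B \<in> sets borel \<Longrightarrow>
      AE \<omega> in M. real_cond_exp M (H t) (\<lambda>\<omega>. indicator B (a t \<omega>)) \<omega> = measure_pmf.prob (p t \<omega>) B"
begin

lemma a_meas: "t \<in> {1..T} \<Longrightarrow> a t \<in> borel_measurable M"
  using action_adapted[of t "Suc t"] past_subalgebra measurable_from_subalg by blast

lemma l_meas: "t \<in> {1..T} \<Longrightarrow> l t \<in> borel_measurable M"
  using loss_adapted[of t "Suc t"] past_subalgebra measurable_from_subalg by blast

lemma norm_action: "t \<in> {1..T} \<Longrightarrow> b \<in> A t \<Longrightarrow> norm b \<le> 1"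
  using action_set by blast

lemma A_subset_cball: "t \<in> {1..T} \<Longrightarrow> A t \<subseteq> cball 0 1"
  using norm_action by fastforce

lemma norm_a: "t \<in> {1..T} \<Longrightarrow> \<omega> \<in> space M \<Longrightarrow> norm (a t \<omega>) \<le> 1"
  using action_in norm_action by blast

lemma A_nonempty: "t \<in> {1..T} \<Longrightarrow> A t \<noteq> {}"
  using action_in not_empty by blast

lemma space_H: "space (H t) = space M"
  using past_subalgebra[of t] by (simp add: subalgebra_def)

lemma mean_bounded: "t \<in> {1..T} \<Longrightarrow> b \<in> A t \<Longrightarrow> \<bar>\<mu> b (x t)\<bar> \<le> 1"
  using mean_range[OF norm_action context_in] by (auto simp: abs_le_iff)

text \<open>Since the oracle bound holds for every sequence, at a fixed outcome one may divert the play in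
  round \<open>t\<close> to an arbitrary action and loss, and continue with zero actions and losses,
  which contribute nothing.\<close>

lemma regression_regret_diverted:
  assumes t: "t \<in> {1..T}" and \<omega>: "\<omega> \<in> space M" and f: "f \<in> F" and v: "norm v \<le> 1" and y: "\<bar>y\<bar> \<le> 1"
  shows "(\<Sum>s=1..<t. (a s \<omega> \<bullet> \<theta> s \<omega> - l s \<omega>)\<^sup>2 - (a s \<omega> \<bullet> f (x s) - l s \<omega>)\<^sup>2)
    + ((v \<bullet> \<theta> t \<omega> - y)\<^sup>2 - (v \<bullet> f (x t) - y)\<^sup>2) \<le> R"
proof -
  define a' where "a' s = (if s < t then a s \<omega> else if s = t then v else 0)" for s
  define l' where "l' s = (if s < t then l s \<omega> else if s = t then y else 0)" for s
  have "\<forall>s\<in>{1..T}. x s \<in> X \<and> norm (a' s) \<le> 1 \<and> l' s \<in> {-1..1}"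
    using context_in norm_a \<omega> v y loss_range by (auto simp: a'_def l'_def abs_le_iff)
  then have "(\<Sum>s=1..T. (a' s \<bullet> oracle_prediction orc x a' l' s - l' s)\<^sup>2)
      - (INF f\<in>F. \<Sum>s=1..T. (a' s \<bullet> f (x s) - l' s)\<^sup>2) \<le> R"
    using regression_regret unfolding square_loss_oracle_def by blast
  moreover have "(INF f\<in>F. \<Sum>s=1..T. (a' s \<bullet> f (x s) - l' s)\<^sup>2) \<le> (\<Sum>s=1..T. (a' s \<bullet> f (x s) - l' s)\<^sup>2)"
    by (rule cINF_lower[OF _ f]) (auto intro!: bdd_belowI2[of _ 0] sum_nonneg)
  ultimately have le: "(\<Sum>s=1..T. (a' s \<bullet> oracle_prediction orc x a' l' s - l' s)\<^sup>2 - (a' s \<bullet> f (x s) - l' s)\<^sup>2) \<le> R"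
    by (simp add: sum_subtractf)
  have "{1..T} = {1..<t} \<union> ({t} \<union> {t<..T})"
    using t by auto
  then have "(\<Sum>s=1..T. g s) = (\<Sum>s=1..<t. g s) + (g t + (\<Sum>s\<in>{t<..T}. g s))" for g :: "nat \<Rightarrow> real"
    by (simp add: sum.union_disjoint disjoint_iff)
  note split = this
  \<comment> \<open>A prediction in round s sees only the rounds before s, so the diverted sequence
    receives the original predictions up to and including round \<open>t\<close>.\<close>
  have pred: "oracle_prediction orc x a' l' s = \<theta> s \<omega>" if "1 \<le> s" "s \<le> t" for s
  proof -
    have "map (\<lambda>s. (x s, a' s, l' s)) [1..<s] = map (\<lambda>s. (x s, a s \<omega>, l s \<omega>)) [1..<s]"
      using that by (auto simp: a'_def l'_def)
    moreover have "s \<in> {1..T}"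
      using that t by simp
    ultimately show ?thesis
      by (simp only: \<theta>_eq[OF _ \<omega>] oracle_prediction_def)
  qed
  have "(\<Sum>s=1..<t. (a' s \<bullet> oracle_prediction orc x a' l' s - l' s)\<^sup>2 - (a' s \<bullet> f (x s) - l' s)\<^sup>2)
      = (\<Sum>s=1..<t. (a s \<omega> \<bullet> \<theta> s \<omega> - l s \<omega>)\<^sup>2 - (a s \<omega> \<bullet> f (x s) - l s \<omega>)\<^sup>2)"
    by (intro sum.cong) (auto simp: pred a'_def l'_def)
  moreover have "(\<Sum>s\<in>{t<..T}. (a' s \<bullet> oracle_prediction orc x a' l' s - l' s)\<^sup>2 - (a' s \<bullet> f (x s) - l' s)\<^sup>2) = 0"
    by (intro sum.neutral) (auto simp: a'_def l'_def)
  moreover have "(a' t \<bullet> oracle_prediction orc x a' l' t - l' t)\<^sup>2 - (a' t \<bullet> f (x t) - l' t)\<^sup>2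
      = (v \<bullet> \<theta> t \<omega> - y)\<^sup>2 - (v \<bullet> f (x t) - y)\<^sup>2"
    using t by (simp add: pred) (simp add: a'_def l'_def)
  ultimately show ?thesis
    using le split[of "\<lambda>s. (a' s \<bullet> oracle_prediction orc x a' l' s - l' s)\<^sup>2 - (a' s \<bullet> f (x s) - l' s)\<^sup>2"]
    by linarith
qed

text \<open>Diverting the last round to the action and loss that actually occurred changes
  nothing.\<close>

lemma regression_regret_on_policy:
  assumes \<omega>: "\<omega> \<in> space M" and f: "f \<in> F"
  shows "(\<Sum>t=1..T. (a t \<omega> \<bullet> \<theta> t \<omega> - l t \<omega>)\<^sup>2 - (a t \<omega> \<bullet> f (x t) - l t \<omega>)\<^sup>2) \<le> R"
proof -
  have T: "T \<in> {1..T}"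
    using horizon_pos by simp
  have "\<bar>l T \<omega>\<bar> \<le> 1"
    using loss_range[OF T \<omega>] by (auto simp: abs_le_iff)
  then have "(\<Sum>s=1..<T. (a s \<omega> \<bullet> \<theta> s \<omega> - l s \<omega>)\<^sup>2 - (a s \<omega> \<bullet> f (x s) - l s \<omega>)\<^sup>2)
    + ((a T \<omega> \<bullet> \<theta> T \<omega> - l T \<omega>)\<^sup>2 - (a T \<omega> \<bullet> f (x T) - l T \<omega>)\<^sup>2) \<le> R"
    by (intro regression_regret_diverted[OF T \<omega> f norm_a[OF T \<omega>]])
  then show ?thesis
    using horizon_pos by (simp add: atLeastLessThanSuc_atLeastAtMost[symmetric])
qed

lemma R_nonneg: "0 \<le> R"
proof -
  obtain f where f: "f \<in> F"
    using F_nonempty by blast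
  obtain \<omega> where \<omega>: "\<omega> \<in> space M"
    using not_empty by blast
  \<comment> \<open>Round 1 has no past, and zero action with zero loss makes both squared losses
    vanish.\<close>
  show ?thesis
    using regression_regret_diverted[of 1 \<omega> f 0 0] f \<omega> horizon_pos by simp
qed

text \<open>Diverting round t to the unit vector along the prediction, with loss 0, makes the oracle
  pay the squared norm of that prediction, while the losses of a fixed f over finitely many rounds
  are bounded. The integrability of everything containing \<theta> rests on this.\<close>

lemma \<theta>_bounded: "\<exists>C. \<forall>t\<in>{1..T}. \<forall>\<omega>\<in>space M. norm (\<theta> t \<omega>) \<le> C"
proof -
  obtain f where f: "f \<in> F"
    using F_nonempty by blast
  define C where "C = R + (\<Sum>s=1..T. (norm (f (x s)) + 1)\<^sup>2)"
  have "norm (\<theta> t \<omega>) \<le> sqrt C" if t: "t \<in> {1..T}" and \<omega>: "\<omega> \<in> space M" for t \<omega>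
  proof -
    define v where "v = sgn (\<theta> t \<omega>)"
    have v: "norm v \<le> 1"
      by (simp add: v_def norm_sgn)
    have v\<theta>: "v \<bullet> \<theta> t \<omega> = norm (\<theta> t \<omega>)"
      by (cases "\<theta> t \<omega> = 0") (simp_all add: v_def sgn_div_norm inner_commute power2_norm_eq_inner[symmetric] power2_eq_square)
    have inner_le: "\<bar>w \<bullet> f (x s)\<bar> \<le> norm (f (x s))" if "norm w \<le> 1" for w s
      using Cauchy_Schwarz_ineq2[of w "f (x s)"] mult_right_mono[OF that, of "norm (f (x s))"] by simp
    have le: "(a s \<omega> \<bullet> f (x s) - l s \<omega>)\<^sup>2 \<le> (norm (f (x s)) + 1)\<^sup>2" if "s \<in> {1..T}" for s
      using inner_le[OF norm_a[OF that \<omega>], of s] loss_range[OF that \<omega>]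
      by (intro abs_le_square_iff[THEN iffD1]) (auto simp: abs_le_iff)
    have "- (norm (f (x s)) + 1)\<^sup>2 \<le> (a s \<omega> \<bullet> \<theta> s \<omega> - l s \<omega>)\<^sup>2 - (a s \<omega> \<bullet> f (x s) - l s \<omega>)\<^sup>2" if "s \<in> {1..T}" for s
      using le[OF that] zero_le_power2[of "a s \<omega> \<bullet> \<theta> s \<omega> - l s \<omega>"] by linarith
    then have "(\<Sum>s=1..<t. - (norm (f (x s)) + 1)\<^sup>2)
        \<le> (\<Sum>s=1..<t. (a s \<omega> \<bullet> \<theta> s \<omega> - l s \<omega>)\<^sup>2 - (a s \<omega> \<bullet> f (x s) - l s \<omega>)\<^sup>2)"
      using t by (intro sum_mono) auto
    moreover have "(v \<bullet> f (x t))\<^sup>2 \<le> (norm (f (x t)) + 1)\<^sup>2"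
      using inner_le[OF v, of t] by (intro abs_le_square_iff[THEN iffD1]) auto
    ultimately have "(norm (\<theta> t \<omega>))\<^sup>2 \<le> R + ((\<Sum>s=1..<t. (norm (f (x s)) + 1)\<^sup>2) + (norm (f (x t)) + 1)\<^sup>2)"
      using regression_regret_diverted[OF t \<omega> f v, of 0] v\<theta> by (simp add: sum_negf)
    also have "(\<Sum>s=1..<t. (norm (f (x s)) + 1)\<^sup>2) + (norm (f (x t)) + 1)\<^sup>2 = (\<Sum>s\<in>insert t {1..<t}. (norm (f (x s)) + 1)\<^sup>2)"
      by simp
    also have "R + \<dots> \<le> C"
      unfolding C_def using t by (intro add_left_mono sum_mono2) auto
    finally show ?thesis
      by (rule real_le_rsqrt)
  qed
  then show ?thesis
    by blast
qed

lemma \<theta>_component: "t \<in> {1..T} \<Longrightarrow> bounded_rv (H t) (\<lambda>\<omega>. \<theta> t \<omega> $ i)"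
  using \<theta>_bounded \<theta>_meas bounded_rv_component[of "\<theta> t" "H t"] by (metis space_H)

lemma \<theta>_component_M: "t \<in> {1..T} \<Longrightarrow> bounded_rv M (\<lambda>\<omega>. \<theta> t \<omega> $ i)"
  using \<theta>_component past_subalgebra bounded_rv_subalgebra by blast

lemma a_component: "t \<in> {1..T} \<Longrightarrow> bounded_rv M (\<lambda>\<omega>. a t \<omega> $ i)"
  by (rule bounded_rv_component[where C = 1]) (auto simp: a_meas norm_a)

lemma l_bounded_rv: "t \<in> {1..T} \<Longrightarrow> bounded_rv M (l t)"
  using loss_range by (intro bounded_rvI[of _ _ 1] l_meas) (auto simp: abs_le_iff)

lemma \<mu>_bounded_rv: "t \<in> {1..T} \<Longrightarrow> bounded_rv M (\<lambda>\<omega>. \<mu> (a t \<omega>) (x t))"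
  using mean_bounded action_in by (intro bounded_rvI[of _ _ 1] mean_measurable) auto

lemma a_inner_bounded_rv:
  assumes "t \<in> {1..T}"
  shows "bounded_rv M (\<lambda>\<omega>. a t \<omega> \<bullet> \<theta> t \<omega>)" "bounded_rv M (\<lambda>\<omega>. a t \<omega> \<bullet> z)"
    "bounded_rv M (\<lambda>\<omega>. v \<bullet> \<theta> t \<omega>)"
  using assms by (intro bounded_rv_inner a_component \<theta>_component_M bounded_rv_const; simp)+

lemmas bounded_rvs = a_inner_bounded_rv \<mu>_bounded_rv l_bounded_rv bounded_rv_const

lemma
  assumes t: "t \<in> {1..T}" and g: "g \<in> borel_measurable borel" "\<And>v. norm v \<le> 1 \<Longrightarrow> \<bar>g v\<bar> \<le> D"
  shows pmf_expectation_bounded_rv: "bounded_rv (H t) (\<lambda>\<omega>. measure_pmf.expectation (p t \<omega>) g)"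
    and expectation_action: "bounded_rv (H t) Z \<Longrightarrow>
      expectation (\<lambda>\<omega>. Z \<omega> * g (a t \<omega>)) = expectation (\<lambda>\<omega>. Z \<omega> * measure_pmf.expectation (p t \<omega>) g)"
proof -
  \<comment> \<open>Actions stay in the unit ball, so cutting \<open>g\<close> off outside of it
    changes neither side and supplies the global bound that \<open>expectation_pmf_kernel\<close>
    requires.\<close>
  define h where "h v = (if norm v \<le> 1 then g v else 0)" for v
  have "0 \<le> D"
    using order_trans[OF abs_ge_zero g(2)[of 0]] by simp
  have h_meas: "h \<in> borel_measurable borel"
    unfolding h_def using g(1) by measurable
  have h_le: "\<bar>h v\<bar> \<le> D" for v
    using g(2) \<open>0 \<le> D\<close> by (auto simp: h_def)
  note h = h_meas h_le
  have sup: "set_pmf (p t \<omega>) \<subseteq> cball 0 1" if "\<omega> \<in> space M" for \<omega>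
    using p_barrier[OF t that] A_subset_cball[OF t]
    by (auto simp: logdet_barrier_def is_arg_min_def distributions_on_def)
  have eq: "measure_pmf.expectation (p t \<omega>) h = measure_pmf.expectation (p t \<omega>) g" if "\<omega> \<in> space M" for \<omega>
    using sup[OF that] by (intro integral_cong_AE) (auto simp: AE_measure_pmf_iff h_def)
  have "\<bar>measure_pmf.expectation (p t \<omega>) h\<bar> \<le> D" for \<omega>
  proof -
    have "\<bar>measure_pmf.expectation (p t \<omega>) h\<bar> \<le> measure_pmf.expectation (p t \<omega>) (\<lambda>v. \<bar>h v\<bar>)"
      by (rule integral_abs_bound)
    also have "\<dots> \<le> measure_pmf.expectation (p t \<omega>) (\<lambda>v. D)"
      using h(2) \<open>0 \<le> D\<close> by (intro integral_mono measure_pmf.integrable_const_bound[of _ D]) auto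
    finally show ?thesis
      by simp
  qed
  then have "bounded_rv (H t) (\<lambda>\<omega>. measure_pmf.expectation (p t \<omega>) h)"
    by (intro bounded_rvI borel_measurable_pmf_kernel[OF past_subalgebra a_meas[OF t] p_meas[OF t] p_cond[OF t] h])
  then show "bounded_rv (H t) (\<lambda>\<omega>. measure_pmf.expectation (p t \<omega>) g)"
    by (rule bounded_rv_cong) (simp add: eq space_H)
  assume "bounded_rv (H t) Z"
  then obtain C where Z: "Z \<in> borel_measurable (H t)" "\<And>\<omega>. \<omega> \<in> space M \<Longrightarrow> \<bar>Z \<omega>\<bar> \<le> C"
    by (auto simp: bounded_rv_def space_H)
  have "expectation (\<lambda>\<omega>. Z \<omega> * h (a t \<omega>)) = expectation (\<lambda>\<omega>. Z \<omega> * measure_pmf.expectation (p t \<omega>) h)"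
    by (rule expectation_pmf_kernel[OF past_subalgebra a_meas[OF t] p_meas[OF t] p_cond[OF t] h Z])
  moreover have "expectation (\<lambda>\<omega>. Z \<omega> * h (a t \<omega>)) = expectation (\<lambda>\<omega>. Z \<omega> * g (a t \<omega>))"
    by (intro Bochner_Integration.integral_cong) (auto simp: h_def norm_a[OF t])
  moreover have "expectation (\<lambda>\<omega>. Z \<omega> * measure_pmf.expectation (p t \<omega>) h)
      = expectation (\<lambda>\<omega>. Z \<omega> * measure_pmf.expectation (p t \<omega>) g)"
    by (intro Bochner_Integration.integral_cong) (auto simp: eq)
  ultimately show "expectation (\<lambda>\<omega>. Z \<omega> * g (a t \<omega>)) = expectation (\<lambda>\<omega>. Z \<omega> * measure_pmf.expectation (p t \<omega>) g)"
    by simp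
qed

section \<open>Approximation error of a comparator and the noise of the losses\<close>

definition approx_error :: "('x \<Rightarrow> real^'d) \<Rightarrow> nat \<Rightarrow> real" where
  "approx_error f t = (SUP b\<in>A t. (b \<bullet> f (x t) - \<mu> b (x t))\<^sup>2)"

text \<open>A real supremum dominates its terms only if they are bounded above; here actions of norm
  at most 1 and means in [-1, 1] provide the bound.\<close>

lemma approx_error_ge:
  assumes t: "t \<in> {1..T}" and b: "b \<in> A t"
  shows "(b \<bullet> f (x t) - \<mu> b (x t))\<^sup>2 \<le> approx_error f t"
  unfolding approx_error_def
proof (rule cSUP_upper[OF b], rule bdd_aboveI2)
  fix v assume v: "v \<in> A t"
  have "\<bar>v \<bullet> f (x t)\<bar> \<le> norm (f (x t))"
    using Cauchy_Schwarz_ineq2[of v "f (x t)"] mult_right_mono[OF norm_action[OF t v], of "norm (f (x t))"] by simp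
  then show "(v \<bullet> f (x t) - \<mu> v (x t))\<^sup>2 \<le> (norm (f (x t)) + 1)\<^sup>2"
    using mean_bounded[OF t v] by (intro abs_le_square_iff[THEN iffD1]) (auto simp: abs_le_iff)
qed

lemma approx_error_nonneg: "t \<in> {1..T} \<Longrightarrow> 0 \<le> approx_error f t"
  using A_nonempty approx_error_ge[of t _ f] zero_le_power2 order_trans by (metis all_not_in_conv)

lemma approx_error_abs_le:
  "t \<in> {1..T} \<Longrightarrow> b \<in> A t \<Longrightarrow> \<bar>b \<bullet> f (x t) - \<mu> b (x t)\<bar> \<le> sqrt (approx_error f t)"
  using approx_error_ge real_le_rsqrt by (metis power2_abs)

lemma past_and_action_subalgebra:
  assumes t: "t \<in> {1..T}"
  shows "subalgebra M (past_and_action M (H t) (a t))" "subalgebra (past_and_action M (H t) (a t)) (H t)"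
    "a t \<in> borel_measurable (past_and_action M (H t) (a t))"
proof -
  let ?G = "sets (H t) \<union> {a t -` B \<inter> space M | B. B \<in> sets borel}"
  have "sets (H t) \<subseteq> sets M"
    using past_subalgebra by (simp add: subalgebra_def)
  then have G: "?G \<subseteq> sets M"
    using measurable_sets[OF a_meas[OF t]] by auto
  then have "?G \<subseteq> Pow (space M)"
    using sets.space_closed by blast
  then have sets: "sets (past_and_action M (H t) (a t)) = sigma_sets (space M) ?G"
    and space: "space (past_and_action M (H t) (a t)) = space M"
    unfolding past_and_action_def by (simp_all add: sets_measure_of space_measure_of)
  show "subalgebra M (past_and_action M (H t) (a t))"
    unfolding subalgebra_def sets space using sets.sigma_sets_subset[OF G] by simp
  show "subalgebra (past_and_action M (H t) (a t)) (H t)"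
    unfolding subalgebra_def sets space by (auto simp: space_H)
  show "a t \<in> borel_measurable (past_and_action M (H t) (a t))"
    by (rule measurableI) (auto simp: sets space)
qed

lemma expectation_loss:
  assumes t: "t \<in> {1..T}" and Z: "bounded_rv (past_and_action M (H t) (a t)) Z"
  shows "expectation (\<lambda>\<omega>. Z \<omega> * l t \<omega>) = expectation (\<lambda>\<omega>. Z \<omega> * \<mu> (a t \<omega>) (x t))"
proof -
  obtain C where "Z \<in> borel_measurable (past_and_action M (H t) (a t))" "\<And>\<omega>. \<omega> \<in> space M \<Longrightarrow> \<bar>Z \<omega>\<bar> \<le> C"
    using Z past_and_action_subalgebra(1)[OF t] by (auto simp: bounded_rv_def subalgebra_def)
  then show ?thesis
    using loss_range[OF t] mean_measurable[OF t] loss_mean[OF t]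
    by (intro real_cond_exp_test[OF past_and_action_subalgebra(1)[OF t] _ _ l_meas[OF t], of _ C 1]) (auto simp: abs_le_iff)
qed

text \<open>The difference of two squared losses is affine in the loss: its square cancels, and the
  slope is determined by past and action. Conditioning therefore replaces the loss by its mean, and
  the noise variance never enters.\<close>

lemma expectation_excess:
  assumes t: "t \<in> {1..T}"
  shows "expectation (\<lambda>\<omega>. (a t \<omega> \<bullet> \<theta> t \<omega> - l t \<omega>)\<^sup>2 - (a t \<omega> \<bullet> z - l t \<omega>)\<^sup>2)
    = expectation (\<lambda>\<omega>. (a t \<omega> \<bullet> \<theta> t \<omega> - \<mu> (a t \<omega>) (x t))\<^sup>2) - expectation (\<lambda>\<omega>. (a t \<omega> \<bullet> z - \<mu> (a t \<omega>) (x t))\<^sup>2)"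
proof -
  let ?G = "past_and_action M (H t) (a t)"
  let ?m = "\<lambda>\<omega>. \<mu> (a t \<omega>) (x t)"
  let ?Z = "\<lambda>\<omega>. a t \<omega> \<bullet> (\<theta> t \<omega> - z)"
  have sp: "space ?G = space M"
    using past_and_action_subalgebra(1)[OF t] by (simp add: subalgebra_def)
  have "bounded_rv ?G (\<lambda>\<omega>. a t \<omega> $ i)" for i
    by (rule bounded_rv_component[OF past_and_action_subalgebra(3)[OF t], where C = 1]) (simp add: sp norm_a[OF t])
  moreover have "bounded_rv ?G (\<lambda>\<omega>. \<theta> t \<omega> $ i)" for i
    by (rule bounded_rv_subalgebra[OF past_and_action_subalgebra(2)[OF t] \<theta>_component[OF t]])
  ultimately have Z: "bounded_rv ?G ?Z"
    by (intro bounded_rv_inner) auto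
  then have ZM: "bounded_rv M ?Z"
    by (rule bounded_rv_subalgebra[OF past_and_action_subalgebra(1)[OF t]])
  have "expectation (\<lambda>\<omega>. (a t \<omega> \<bullet> \<theta> t \<omega> - l t \<omega>)\<^sup>2 - (a t \<omega> \<bullet> z - l t \<omega>)\<^sup>2)
      = expectation (\<lambda>\<omega>. ((a t \<omega> \<bullet> \<theta> t \<omega> - ?m \<omega>)\<^sup>2 - (a t \<omega> \<bullet> z - ?m \<omega>)\<^sup>2)
          + 2 * (?Z \<omega> * ?m \<omega>) - 2 * (?Z \<omega> * l t \<omega>))"
    by (intro Bochner_Integration.integral_cong) (auto simp: inner_diff_right power2_eq_square algebra_simps)
  also have "\<dots> = expectation (\<lambda>\<omega>. (a t \<omega> \<bullet> \<theta> t \<omega> - ?m \<omega>)\<^sup>2) - expectation (\<lambda>\<omega>. (a t \<omega> \<bullet> z - ?m \<omega>)\<^sup>2)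
      + 2 * expectation (\<lambda>\<omega>. ?Z \<omega> * ?m \<omega>) - 2 * expectation (\<lambda>\<omega>. ?Z \<omega> * l t \<omega>)"
  proof -
    have "integrable M (\<lambda>\<omega>. (a t \<omega> \<bullet> \<theta> t \<omega> - ?m \<omega>)\<^sup>2)" "integrable M (\<lambda>\<omega>. (a t \<omega> \<bullet> z - ?m \<omega>)\<^sup>2)"
      "integrable M (\<lambda>\<omega>. ?Z \<omega> * ?m \<omega>)" "integrable M (\<lambda>\<omega>. ?Z \<omega> * l t \<omega>)"
      using t by (intro bounded_rv_integrable bounded_rv_power2 bounded_rv_diff bounded_rv_mult bounded_rvs ZM; simp)+
    then show ?thesis
      by simp
  qed
  finally show ?thesis
    using expectation_loss[OF t Z] by simp
qed

lemma expectation_double_sum: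
  assumes "\<And>i j. bounded_rv M (f i j)"
  shows "expectation (\<lambda>\<omega>. \<Sum>i\<in>I. \<Sum>j\<in>J. f i j \<omega>) = (\<Sum>i\<in>I. \<Sum>j\<in>J. expectation (f i j))"
proof -
  have "expectation (\<lambda>\<omega>. \<Sum>i\<in>I. \<Sum>j\<in>J. f i j \<omega>) = (\<Sum>i\<in>I. expectation (\<lambda>\<omega>. \<Sum>j\<in>J. f i j \<omega>))"
    by (intro Bochner_Integration.integral_sum bounded_rv_integrable bounded_rv_sum assms)
  also have "\<dots> = (\<Sum>i\<in>I. \<Sum>j\<in>J. expectation (f i j))"
    by (intro sum.cong refl Bochner_Integration.integral_sum bounded_rv_integrable assms)
  finally show ?thesis .
qed

section \<open>Prediction error on and off the played actions\<close>

lemma expectation_mono: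
  assumes "bounded_rv M f" "bounded_rv M g" "\<And>\<omega>. \<omega> \<in> space M \<Longrightarrow> f \<omega> \<le> g \<omega>"
  shows "expectation f \<le> expectation g"
  using assms by (intro integral_mono) auto

lemma expectation_le_const:
  assumes "bounded_rv M f" "\<And>\<omega>. \<omega> \<in> space M \<Longrightarrow> f \<omega> \<le> c"
  shows "expectation f \<le> c"
  using expectation_mono[OF assms(1) bounded_rv_const[of M c]] assms(2) by (simp add: prob_space)

lemma expectation_approx_error_le:
  assumes t: "t \<in> {1..T}"
  shows "expectation (\<lambda>\<omega>. (a t \<omega> \<bullet> f (x t) - \<mu> (a t \<omega>) (x t))\<^sup>2) \<le> approx_error f t"
  by (intro expectation_le_const bounded_rv_power2 bounded_rv_diff bounded_rvs approx_error_ge action_in t)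

lemma bounded_rv_excess:
  "t \<in> {1..T} \<Longrightarrow> bounded_rv M (\<lambda>\<omega>. (a t \<omega> \<bullet> \<theta> t \<omega> - l t \<omega>)\<^sup>2 - (a t \<omega> \<bullet> z - l t \<omega>)\<^sup>2)"
  by (intro bounded_rv_diff bounded_rv_power2 bounded_rvs; simp)

lemma prediction_error_on_policy:
  assumes f: "f \<in> F"
  shows "(\<Sum>t=1..T. expectation (\<lambda>\<omega>. (a t \<omega> \<bullet> \<theta> t \<omega> - \<mu> (a t \<omega>) (x t))\<^sup>2)
      - expectation (\<lambda>\<omega>. (a t \<omega> \<bullet> f (x t) - \<mu> (a t \<omega>) (x t))\<^sup>2)) \<le> R"
proof -
  have "expectation (\<lambda>\<omega>. \<Sum>t=1..T. (a t \<omega> \<bullet> \<theta> t \<omega> - l t \<omega>)\<^sup>2 - (a t \<omega> \<bullet> f (x t) - l t \<omega>)\<^sup>2) \<le> R"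
    by (intro expectation_le_const bounded_rv_sum bounded_rv_excess regression_regret_on_policy f) auto
  also have "expectation (\<lambda>\<omega>. \<Sum>t=1..T. (a t \<omega> \<bullet> \<theta> t \<omega> - l t \<omega>)\<^sup>2 - (a t \<omega> \<bullet> f (x t) - l t \<omega>)\<^sup>2)
      = (\<Sum>t=1..T. expectation (\<lambda>\<omega>. (a t \<omega> \<bullet> \<theta> t \<omega> - l t \<omega>)\<^sup>2 - (a t \<omega> \<bullet> f (x t) - l t \<omega>)\<^sup>2))"
    by (intro Bochner_Integration.integral_sum bounded_rv_integrable bounded_rv_excess)
  also have "\<dots> = (\<Sum>t=1..T. expectation (\<lambda>\<omega>. (a t \<omega> \<bullet> \<theta> t \<omega> - \<mu> (a t \<omega>) (x t))\<^sup>2)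
      - expectation (\<lambda>\<omega>. (a t \<omega> \<bullet> f (x t) - \<mu> (a t \<omega>) (x t))\<^sup>2))"
    by (intro sum.cong refl expectation_excess)
  finally show ?thesis .
qed

text \<open>Before round t the oracle may be ahead of \<open>f\<close>, which would leave room for a
  large error at \<open>b\<close>; in expectation this lead is at most the accumulated approximation
  error of \<open>f\<close>, as the noise cancels.\<close>

lemma prediction_error_off_policy:
  assumes f: "f \<in> F" and t: "t \<in> {1..T}" and b: "b \<in> A t"
  shows "expectation (\<lambda>\<omega>. (b \<bullet> \<theta> t \<omega> - \<mu> b (x t))\<^sup>2) \<le> R + (\<Sum>s=1..T. approx_error f s)"
proof -
  let ?e = "\<lambda>s \<omega>. (a s \<omega> \<bullet> \<theta> s \<omega> - l s \<omega>)\<^sup>2 - (a s \<omega> \<bullet> f (x s) - l s \<omega>)\<^sup>2"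
  have bd: "bounded_rv M (\<lambda>\<omega>. \<Sum>s=1..<t. ?e s \<omega>)" "bounded_rv M (\<lambda>\<omega>. (b \<bullet> \<theta> t \<omega> - \<mu> b (x t))\<^sup>2)"
    using t by (auto intro!: bounded_rv_sum bounded_rv_excess bounded_rv_power2 bounded_rv_diff bounded_rvs)
  have "(\<Sum>s=1..<t. ?e s \<omega>) + (b \<bullet> \<theta> t \<omega> - \<mu> b (x t))\<^sup>2 \<le> R + (b \<bullet> f (x t) - \<mu> b (x t))\<^sup>2" if "\<omega> \<in> space M" for \<omega>
    using regression_regret_diverted[OF t that f norm_action[OF t b] mean_bounded[OF t b]] by linarith
  then have "expectation (\<lambda>\<omega>. (\<Sum>s=1..<t. ?e s \<omega>) + (b \<bullet> \<theta> t \<omega> - \<mu> b (x t))\<^sup>2) \<le> R + (b \<bullet> f (x t) - \<mu> b (x t))\<^sup>2"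
    by (intro expectation_le_const bounded_rv_add bd)
  then have "expectation (\<lambda>\<omega>. \<Sum>s=1..<t. ?e s \<omega>) + expectation (\<lambda>\<omega>. (b \<bullet> \<theta> t \<omega> - \<mu> b (x t))\<^sup>2)
      \<le> R + (b \<bullet> f (x t) - \<mu> b (x t))\<^sup>2"
    using bd by (subst (asm) Bochner_Integration.integral_add) auto
  moreover have "expectation (\<lambda>\<omega>. \<Sum>s=1..<t. ?e s \<omega>) = (\<Sum>s=1..<t. expectation (?e s))"
    using t by (intro Bochner_Integration.integral_sum bounded_rv_integrable bounded_rv_excess) auto
  moreover have "(\<Sum>s=1..<t. - approx_error f s) \<le> (\<Sum>s=1..<t. expectation (?e s))"
  proof (rule sum_mono)
    fix s assume "s \<in> {1..<t}"
    then have s: "s \<in> {1..T}"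
      using t by auto
    have "0 \<le> expectation (\<lambda>\<omega>. (a s \<omega> \<bullet> \<theta> s \<omega> - \<mu> (a s \<omega>) (x s))\<^sup>2)"
      by simp
    then show "- approx_error f s \<le> expectation (?e s)"
      unfolding expectation_excess[OF s] using expectation_approx_error_le[OF s, of f] by linarith
  qed
  moreover have "(\<Sum>s=1..<t. approx_error f s) + approx_error f t \<le> (\<Sum>s=1..T. approx_error f s)"
  proof -
    have "(\<Sum>s=1..<t. approx_error f s) + approx_error f t = (\<Sum>s\<in>insert t {1..<t}. approx_error f s)"
      by simp
    also have "\<dots> \<le> (\<Sum>s=1..T. approx_error f s)"
      using t by (intro sum_mono2 approx_error_nonneg) auto
    finally show ?thesis .
  qed
  ultimately show ?thesis
    using approx_error_ge[OF t b, of f] by (simp add: sum_negf)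
qed

text \<open>\<open>z\<close> varies with the past, so the kernel identity for a fixed function of
  the action is not directly applicable; coordinatewise, each summand is a factor known from the
  past times such a function.\<close>

lemma expectation_inner_mean_action:
  assumes t: "t \<in> {1..T}" and z: "\<And>i. bounded_rv (H t) (\<lambda>\<omega>. z \<omega> $ i)"
  shows "bounded_rv (H t) (\<lambda>\<omega>. mean_action (p t \<omega>) \<bullet> z \<omega>)"
    and "expectation (\<lambda>\<omega>. a t \<omega> \<bullet> z \<omega>) = expectation (\<lambda>\<omega>. mean_action (p t \<omega>) \<bullet> z \<omega>)"
proof -
  have g: "(\<lambda>v :: real^'d. v $ i) \<in> borel_measurable borel" "\<And>v :: real^'d. norm v \<le> 1 \<Longrightarrow> \<bar>v $ i\<bar> \<le> 1" for i
    using component_le_norm_cart order_trans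
    by (auto intro!: borel_measurable_continuous_onI continuous_intros) blast
  have p1: "set_pmf (p t \<omega>) \<subseteq> cball 0 1" if "\<omega> \<in> space M" for \<omega>
    using p_barrier[OF t that] A_subset_cball[OF t]
    by (auto simp: logdet_barrier_def is_arg_min_def distributions_on_def)
  have m: "(\<Sum>i\<in>UNIV. z \<omega> $ i * measure_pmf.expectation (p t \<omega>) (\<lambda>v. v $ i)) = mean_action (p t \<omega>) \<bullet> z \<omega>"
    if "\<omega> \<in> space M" for \<omega>
  proof -
    have "measure_pmf.expectation (p t \<omega>) (\<lambda>v. v $ i) = mean_action (p t \<omega>) $ i" for i
      using inner_mean_action[OF p1[OF that], of "axis i 1"] by (simp add: inner_axis')
    then show ?thesis
      by (simp add: inner_vec_def mult.commute)
  qed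
  have bd: "bounded_rv (H t) (\<lambda>\<omega>. z \<omega> $ i * measure_pmf.expectation (p t \<omega>) (\<lambda>v. v $ i))" for i
    by (intro bounded_rv_mult z pmf_expectation_bounded_rv[OF t g])
  have "bounded_rv (H t) (\<lambda>\<omega>. \<Sum>i\<in>UNIV. z \<omega> $ i * measure_pmf.expectation (p t \<omega>) (\<lambda>v. v $ i))"
    by (intro bounded_rv_sum bd)
  then show "bounded_rv (H t) (\<lambda>\<omega>. mean_action (p t \<omega>) \<bullet> z \<omega>)"
    by (rule bounded_rv_cong) (simp add: m space_H)
  have "expectation (\<lambda>\<omega>. a t \<omega> \<bullet> z \<omega>) = expectation (\<lambda>\<omega>. \<Sum>i\<in>UNIV. z \<omega> $ i * a t \<omega> $ i)"
    by (simp add: inner_vec_def mult.commute)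
  also have "\<dots> = (\<Sum>i\<in>UNIV. expectation (\<lambda>\<omega>. z \<omega> $ i * a t \<omega> $ i))"
    by (intro Bochner_Integration.integral_sum bounded_rv_integrable bounded_rv_mult a_component[OF t]
        bounded_rv_subalgebra[OF past_subalgebra z])
  also have "\<dots> = (\<Sum>i\<in>UNIV. expectation (\<lambda>\<omega>. z \<omega> $ i * measure_pmf.expectation (p t \<omega>) (\<lambda>v. v $ i)))"
    by (intro sum.cong refl expectation_action[OF t g z])
  also have "\<dots> = expectation (\<lambda>\<omega>. \<Sum>i\<in>UNIV. z \<omega> $ i * measure_pmf.expectation (p t \<omega>) (\<lambda>v. v $ i))"
    by (intro Bochner_Integration.integral_sum[symmetric] bounded_rv_integrable bounded_rv_subalgebra[OF past_subalgebra bd])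
  also have "\<dots> = expectation (\<lambda>\<omega>. mean_action (p t \<omega>) \<bullet> z \<omega>)"
    by (intro Bochner_Integration.integral_cong) (simp_all add: m)
  finally show "expectation (\<lambda>\<omega>. a t \<omega> \<bullet> z \<omega>) = expectation (\<lambda>\<omega>. mean_action (p t \<omega>) \<bullet> z \<omega>)" .
qed

lemma expectation_inner_square:
  assumes t: "t \<in> {1..T}" and z: "\<And>i. bounded_rv (H t) (\<lambda>\<omega>. z \<omega> $ i)"
  shows "bounded_rv (H t) (\<lambda>\<omega>. measure_pmf.expectation (p t \<omega>) (\<lambda>v. (v \<bullet> z \<omega>)\<^sup>2))"
    and "expectation (\<lambda>\<omega>. (a t \<omega> \<bullet> z \<omega>)\<^sup>2)
      = expectation (\<lambda>\<omega>. measure_pmf.expectation (p t \<omega>) (\<lambda>v. (v \<bullet> z \<omega>)\<^sup>2))"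
proof -
  have comp: "\<bar>v $ i\<bar> \<le> 1" if "norm v \<le> 1" for v :: "real^'d" and i
    using that component_le_norm_cart[of v i] by simp
  have g: "(\<lambda>v :: real^'d. v $ i * v $ j) \<in> borel_measurable borel" "\<And>v :: real^'d. norm v \<le> 1 \<Longrightarrow> \<bar>v $ i * v $ j\<bar> \<le> 1" for i j
    unfolding abs_mult using comp
    by (auto intro!: borel_measurable_continuous_onI continuous_intros mult_le_one)
  have p1: "set_pmf (p t \<omega>) \<subseteq> cball 0 1" if "\<omega> \<in> space M" for \<omega>
    using p_barrier[OF t that] A_subset_cball[OF t]
    by (auto simp: logdet_barrier_def is_arg_min_def distributions_on_def)
  \<comment> \<open>The same separation for the square: monomials of degree two in the action, with
    coefficients that depend on the past only.\<close>
  have sq: "(v \<bullet> w)\<^sup>2 = (\<Sum>i\<in>UNIV. \<Sum>j\<in>UNIV. w $ i * w $ j * (v $ i * v $ j))" for v w :: "real^'d"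
    by (simp add: power2_eq_square inner_vec_def sum_product mult_ac)
  have m: "(\<Sum>i\<in>UNIV. \<Sum>j\<in>UNIV. z \<omega> $ i * z \<omega> $ j * measure_pmf.expectation (p t \<omega>) (\<lambda>v. v $ i * v $ j))
      = measure_pmf.expectation (p t \<omega>) (\<lambda>v. (v \<bullet> z \<omega>)\<^sup>2)" if "\<omega> \<in> space M" for \<omega>
  proof -
    have "integrable (measure_pmf (p t \<omega>)) (\<lambda>v. v $ i * v $ j)" for i j
      using p1[OF that] g(2) by (intro integrable_pmf_bounded[where C = 1]) auto
    then show ?thesis
      unfolding sq by (subst Bochner_Integration.integral_sum, force)+ simp
  qed
  have bd: "bounded_rv (H t) (\<lambda>\<omega>. z \<omega> $ i * z \<omega> $ j * measure_pmf.expectation (p t \<omega>) (\<lambda>v. v $ i * v $ j))" for i j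
    by (intro bounded_rv_mult z pmf_expectation_bounded_rv[OF t g])
  have "bounded_rv (H t) (\<lambda>\<omega>. \<Sum>i\<in>UNIV. \<Sum>j\<in>UNIV.
      z \<omega> $ i * z \<omega> $ j * measure_pmf.expectation (p t \<omega>) (\<lambda>v. v $ i * v $ j))"
    by (intro bounded_rv_sum bd)
  then show "bounded_rv (H t) (\<lambda>\<omega>. measure_pmf.expectation (p t \<omega>) (\<lambda>v. (v \<bullet> z \<omega>)\<^sup>2))"
    by (rule bounded_rv_cong) (simp add: m space_H)
  have zM: "bounded_rv M (\<lambda>\<omega>. z \<omega> $ i)" for i
    by (rule bounded_rv_subalgebra[OF past_subalgebra z])
  have "expectation (\<lambda>\<omega>. (a t \<omega> \<bullet> z \<omega>)\<^sup>2)
      = (\<Sum>i\<in>UNIV. \<Sum>j\<in>UNIV. expectation (\<lambda>\<omega>. z \<omega> $ i * z \<omega> $ j * (a t \<omega> $ i * a t \<omega> $ j)))"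
  proof -
    have "bounded_rv M (\<lambda>\<omega>. z \<omega> $ i * z \<omega> $ j * (a t \<omega> $ i * a t \<omega> $ j))" for i j
      by (intro bounded_rv_mult zM a_component[OF t])
    then show ?thesis
      unfolding sq by (rule expectation_double_sum)
  qed
  also have "\<dots> = (\<Sum>i\<in>UNIV. \<Sum>j\<in>UNIV. expectation (\<lambda>\<omega>. z \<omega> $ i * z \<omega> $ j * measure_pmf.expectation (p t \<omega>) (\<lambda>v. v $ i * v $ j)))"
    by (intro sum.cong refl expectation_action[OF t g] bounded_rv_mult z)
  also have "\<dots> = expectation (\<lambda>\<omega>. \<Sum>i\<in>UNIV. \<Sum>j\<in>UNIV. z \<omega> $ i * z \<omega> $ j * measure_pmf.expectation (p t \<omega>) (\<lambda>v. v $ i * v $ j))"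
    by (rule expectation_double_sum[symmetric, OF bounded_rv_subalgebra[OF past_subalgebra bd]])
  also have "\<dots> = expectation (\<lambda>\<omega>. measure_pmf.expectation (p t \<omega>) (\<lambda>v. (v \<bullet> z \<omega>)\<^sup>2))"
    by (intro Bochner_Integration.integral_cong) (simp_all add: m)
  finally show "expectation (\<lambda>\<omega>. (a t \<omega> \<bullet> z \<omega>)\<^sup>2)
      = expectation (\<lambda>\<omega>. measure_pmf.expectation (p t \<omega>) (\<lambda>v. (v \<bullet> z \<omega>)\<^sup>2))" .
qed

text \<open>For the errors u of \<theta> and w of f against the mean, (u - w)^2 \<le> 2 (u^2 - w^2)
  + 4 w^2. The oracle controls only the differences, so the remaining 4 w^2 is charged to the
  approximation error.\<close>

lemma prediction_error_le:
  assumes t: "t \<in> {1..T}"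
  shows "expectation (\<lambda>\<omega>. (a t \<omega> \<bullet> (\<theta> t \<omega> - f (x t)))\<^sup>2)
    \<le> 2 * (expectation (\<lambda>\<omega>. (a t \<omega> \<bullet> \<theta> t \<omega> - \<mu> (a t \<omega>) (x t))\<^sup>2)
         - expectation (\<lambda>\<omega>. (a t \<omega> \<bullet> f (x t) - \<mu> (a t \<omega>) (x t))\<^sup>2)) + 4 * approx_error f t"
proof -
  let ?u = "\<lambda>\<omega>. a t \<omega> \<bullet> \<theta> t \<omega> - \<mu> (a t \<omega>) (x t)" and ?w = "\<lambda>\<omega>. a t \<omega> \<bullet> f (x t) - \<mu> (a t \<omega>) (x t)"
  have bd: "bounded_rv M ?u" "bounded_rv M ?w"
    using t by (intro bounded_rv_diff bounded_rvs; simp)+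
  have sq: "(a t \<omega> \<bullet> (\<theta> t \<omega> - f (x t)))\<^sup>2 = (?u \<omega> - ?w \<omega>)\<^sup>2" for \<omega>
    by (simp add: inner_diff_right)
  have le: "(u - w)\<^sup>2 \<le> 2 * u\<^sup>2 + 2 * w\<^sup>2" for u w :: real
    using zero_le_power2[of "u + w"] by (simp add: power2_eq_square algebra_simps)
  have "expectation (\<lambda>\<omega>. (?u \<omega> - ?w \<omega>)\<^sup>2) \<le> expectation (\<lambda>\<omega>. 2 * (?u \<omega>)\<^sup>2 + 2 * (?w \<omega>)\<^sup>2)"
    by (intro expectation_mono le bounded_rv_power2 bounded_rv_add bounded_rv_mult bounded_rv_diff bounded_rvs t)
  also have "\<dots> = 2 * expectation (\<lambda>\<omega>. (?u \<omega>)\<^sup>2) + 2 * expectation (\<lambda>\<omega>. (?w \<omega>)\<^sup>2)"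
    using bounded_rv_integrable[OF bounded_rv_power2[OF bd(1)]] bounded_rv_integrable[OF bounded_rv_power2[OF bd(2)]]
    by simp
  finally show ?thesis
    using expectation_approx_error_le[OF t, of f] by (simp add: sq)
qed

text \<open>Passing from the mean to the linear function given by f costs one root of the
  approximation error at the played action and one at the comparator; the rest is
  \<open>logdet_barrier_regret\<close> in expectation.\<close>

lemma round_regret_le:
  assumes \<gamma>: "0 < \<gamma>" and t: "t \<in> {1..T}" and b: "b \<in> A t"
  shows "expectation (\<lambda>\<omega>. \<mu> (a t \<omega>) (x t)) - \<mu> b (x t)
    \<le> 2 * sqrt (approx_error f t) + real CARD('d) / \<gamma>
      + \<gamma> / 4 * expectation (\<lambda>\<omega>. (a t \<omega> \<bullet> (\<theta> t \<omega> - f (x t)))\<^sup>2)"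
proof -
  let ?z = "f (x t)" and ?e = "sqrt (approx_error f t)"
  have z: "bounded_rv (H t) (\<lambda>\<omega>. (\<theta> t \<omega> - ?z) $ i)" for i
    using \<theta>_component[OF t] by auto
  let ?V = "\<lambda>\<omega>. measure_pmf.expectation (p t \<omega>) (\<lambda>v. (v \<bullet> (\<theta> t \<omega> - ?z))\<^sup>2)"
  have "expectation (\<lambda>\<omega>. \<mu> (a t \<omega>) (x t)) \<le> expectation (\<lambda>\<omega>. a t \<omega> \<bullet> ?z + ?e)"
  proof (rule expectation_mono)
    show "\<mu> (a t \<omega>) (x t) \<le> a t \<omega> \<bullet> ?z + ?e" if "\<omega> \<in> space M" for \<omega>
      using approx_error_abs_le[OF t action_in[OF t that], of f] by linarith
  qed (intro bounded_rv_add bounded_rvs t)+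
  also have "\<dots> = expectation (\<lambda>\<omega>. mean_action (p t \<omega>) \<bullet> ?z) + ?e"
    using expectation_inner_mean_action(2)[OF t, of "\<lambda>_. ?z"] bounded_rv_integrable[OF bounded_rvs(2)[OF t, of ?z]]
    by (auto simp: prob_space)
  finally have "expectation (\<lambda>\<omega>. \<mu> (a t \<omega>) (x t)) - \<mu> b (x t)
      \<le> expectation (\<lambda>\<omega>. mean_action (p t \<omega>) \<bullet> ?z) - b \<bullet> ?z + 2 * ?e"
    using approx_error_abs_le[OF t b, of f] by linarith
  moreover have "expectation (\<lambda>\<omega>. mean_action (p t \<omega>) \<bullet> ?z) - b \<bullet> ?z
      = expectation (\<lambda>\<omega>. (mean_action (p t \<omega>) - b) \<bullet> ?z)"
  proof -
    have "bounded_rv M (\<lambda>\<omega>. mean_action (p t \<omega>) \<bullet> ?z)"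
      by (intro bounded_rv_subalgebra[OF past_subalgebra expectation_inner_mean_action(1)[OF t]] bounded_rv_const)
    then have "integrable M (\<lambda>\<omega>. mean_action (p t \<omega>) \<bullet> ?z)"
      by blast
    then show ?thesis
      by (simp add: inner_diff_left prob_space)
  qed
  moreover have "expectation (\<lambda>\<omega>. (mean_action (p t \<omega>) - b) \<bullet> ?z)
      \<le> expectation (\<lambda>\<omega>. real CARD('d) / \<gamma> + \<gamma> / 4 * ?V \<omega>)"
  proof (rule expectation_mono)
    show "(mean_action (p t \<omega>) - b) \<bullet> ?z \<le> real CARD('d) / \<gamma> + \<gamma> / 4 * ?V \<omega>" if "\<omega> \<in> space M" for \<omega>
      by (rule logdet_barrier_regret[OF p_barrier[OF t that] \<gamma> b A_subset_cball[OF t]])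
    show "bounded_rv M (\<lambda>\<omega>. (mean_action (p t \<omega>) - b) \<bullet> ?z)"
      unfolding inner_diff_left
      by (intro bounded_rv_diff bounded_rv_const
          bounded_rv_subalgebra[OF past_subalgebra expectation_inner_mean_action(1)[OF t]])
    show "bounded_rv M (\<lambda>\<omega>. real CARD('d) / \<gamma> + \<gamma> / 4 * ?V \<omega>)"
      by (intro bounded_rv_add bounded_rv_mult bounded_rv_const
          bounded_rv_subalgebra[OF past_subalgebra expectation_inner_square(1)[OF t z]])
  qed
  moreover have "expectation (\<lambda>\<omega>. real CARD('d) / \<gamma> + \<gamma> / 4 * ?V \<omega>)
      = real CARD('d) / \<gamma> + \<gamma> / 4 * expectation (\<lambda>\<omega>. (a t \<omega> \<bullet> (\<theta> t \<omega> - ?z))\<^sup>2)"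
    using bounded_rv_integrable[OF bounded_rv_subalgebra[OF past_subalgebra expectation_inner_square(1)[OF t z]]]
    by (simp add: expectation_inner_square(2)[OF t z] prob_space)
  ultimately show ?thesis
    by linarith
qed

section \<open>Summation over the rounds\<close>

lemma bandit_regret_le:
  assumes "\<And>t b. t \<in> {1..T} \<Longrightarrow> b \<in> A t \<Longrightarrow> expectation (\<lambda>\<omega>. \<mu> (a t \<omega>) (x t)) - \<mu> b (x t) \<le> B t"
  shows "bandit_regret M T x A \<mu> a \<le> (\<Sum>t=1..T. B t)"
proof -
  have "bandit_regret M T x A \<mu> a
      = (\<Sum>t=1..T. expectation (\<lambda>\<omega>. \<mu> (a t \<omega>) (x t) - (INF b\<in>A t. \<mu> b (x t))))"
    unfolding bandit_regret_def
    by (intro Bochner_Integration.integral_sum bounded_rv_integrable bounded_rv_diff bounded_rvs)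
  also have "\<dots> \<le> (\<Sum>t=1..T. B t)"
  proof (rule sum_mono)
    fix t assume t: "t \<in> {1..T}"
    have "expectation (\<lambda>\<omega>. \<mu> (a t \<omega>) (x t)) - B t \<le> (INF b\<in>A t. \<mu> b (x t))"
    proof (rule cINF_greatest[OF A_nonempty[OF t]])
      show "expectation (\<lambda>\<omega>. \<mu> (a t \<omega>) (x t)) - B t \<le> \<mu> b (x t)" if "b \<in> A t" for b
        using assms[OF t that] by linarith
    qed
    then show "expectation (\<lambda>\<omega>. \<mu> (a t \<omega>) (x t) - (INF b\<in>A t. \<mu> b (x t))) \<le> B t"
      using bounded_rv_integrable[OF bounded_rvs(4)[OF t]] by (simp add: prob_space)
  qed
  finally show ?thesis .
qed

lemma bandit_regret_le_approx_error:
  assumes \<gamma>: "0 < \<gamma>" and f: "f \<in> F"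
  shows "bandit_regret M T x A \<mu> a \<le> 2 * (\<Sum>t=1..T. sqrt (approx_error f t))
    + real CARD('d) * real T / \<gamma> + \<gamma> * (R / 2 + (\<Sum>t=1..T. approx_error f t))"
proof -
  let ?D = "\<lambda>t. expectation (\<lambda>\<omega>. (a t \<omega> \<bullet> \<theta> t \<omega> - \<mu> (a t \<omega>) (x t))\<^sup>2)
         - expectation (\<lambda>\<omega>. (a t \<omega> \<bullet> f (x t) - \<mu> (a t \<omega>) (x t))\<^sup>2)"
  let ?d = "real CARD('d)" and ?e = "approx_error f"
  have "bandit_regret M T x A \<mu> a \<le> (\<Sum>t=1..T. 2 * sqrt (?e t) + ?d / \<gamma> + \<gamma> / 4 * (2 * ?D t + 4 * ?e t))"
  proof (rule bandit_regret_le)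
    fix t b assume t: "t \<in> {1..T}" and b: "b \<in> A t"
    have "\<gamma> / 4 * expectation (\<lambda>\<omega>. (a t \<omega> \<bullet> (\<theta> t \<omega> - f (x t)))\<^sup>2) \<le> \<gamma> / 4 * (2 * ?D t + 4 * ?e t)"
      using \<gamma> by (intro mult_left_mono prediction_error_le[OF t]) simp
    then show "expectation (\<lambda>\<omega>. \<mu> (a t \<omega>) (x t)) - \<mu> b (x t)
        \<le> 2 * sqrt (?e t) + ?d / \<gamma> + \<gamma> / 4 * (2 * ?D t + 4 * ?e t)"
      using round_regret_le[OF \<gamma> t b, of f] by linarith
  qed
  also have "\<dots> = 2 * (\<Sum>t=1..T. sqrt (?e t)) + ?d * real T / \<gamma> + \<gamma> * ((\<Sum>t=1..T. ?D t) / 2 + (\<Sum>t=1..T. ?e t))"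
  proof -
    have "(\<Sum>t=1..T. 2 * sqrt (?e t) + ?d / \<gamma> + \<gamma> / 4 * (2 * ?D t + 4 * ?e t))
        = (\<Sum>t=1..T. 2 * sqrt (?e t) + ?d / \<gamma> + (\<gamma> / 2 * ?D t + \<gamma> * ?e t))"
      by (intro sum.cong) (auto simp: field_simps)
    also have "\<dots> = 2 * (\<Sum>t=1..T. sqrt (?e t)) + real T * (?d / \<gamma>) + (\<gamma> / 2 * (\<Sum>t=1..T. ?D t) + \<gamma> * (\<Sum>t=1..T. ?e t))"
      by (simp only: sum.distrib sum_distrib_left[symmetric]) simp
    finally show ?thesis
      by (simp add: algebra_simps)
  qed
  also have "\<dots> \<le> 2 * (\<Sum>t=1..T. sqrt (?e t)) + ?d * real T / \<gamma> + \<gamma> * (R / 2 + (\<Sum>t=1..T. ?e t))"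
  proof -
    have "(\<Sum>t=1..T. ?D t) / 2 + (\<Sum>t=1..T. ?e t) \<le> R / 2 + (\<Sum>t=1..T. ?e t)"
      using prediction_error_on_policy[OF f] by linarith
    then have "\<gamma> * ((\<Sum>t=1..T. ?D t) / 2 + (\<Sum>t=1..T. ?e t)) \<le> \<gamma> * (R / 2 + (\<Sum>t=1..T. ?e t))"
      using \<gamma> by (intro mult_left_mono) auto
    then show ?thesis
      by linarith
  qed
  finally show ?thesis .
qed

lemma approx_error_small:
  assumes "misspecification F \<mu> T x A < e"
  shows "\<exists>f\<in>F. (\<Sum>t=1..T. approx_error f t) \<le> real T * e\<^sup>2"
proof -
  have bdd: "bdd_below ((\<lambda>f. sqrt (1 / real T * (\<Sum>t=1..T. approx_error f t))) ` F)"
    by (intro bdd_belowI2[of _ 0] real_sqrt_ge_zero mult_nonneg_nonneg sum_nonneg approx_error_nonneg) auto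
  have "(INF f\<in>F. sqrt (1 / real T * (\<Sum>t=1..T. approx_error f t))) < e"
    using assms by (simp add: misspecification_def approx_error_def)
  then obtain f where f: "f \<in> F" "sqrt (1 / real T * (\<Sum>t=1..T. approx_error f t)) < e"
    using cINF_less_iff[OF F_nonempty bdd] by blast
  have "1 / real T * (\<Sum>t=1..T. approx_error f t) \<le> e\<^sup>2"
    using f(2) by (intro sqrt_le_D) simp
  then show ?thesis
    using f(1) horizon_pos by (intro bexI[of _ f]) (auto simp: field_simps)
qed

lemma bandit_regret_le_of_pos:
  assumes \<gamma>: "0 < \<gamma>" and eps: "0 \<le> \<epsilon>" "misspecification F \<mu> T x A \<le> \<epsilon>"
  shows "bandit_regret M T x A \<mu> a
    \<le> 2 * \<epsilon> * real T + real CARD('d) * real T / \<gamma> + \<gamma> * (R / 2 + real T * \<epsilon>\<^sup>2)"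
proof -
  have le: "bandit_regret M T x A \<mu> a
      \<le> 2 * e * real T + real CARD('d) * real T / \<gamma> + \<gamma> * (R / 2 + real T * e\<^sup>2)" if e: "\<epsilon> < e" for e
  proof -
    have "misspecification F \<mu> T x A < e"
      using eps e by linarith
    then obtain f where f: "f \<in> F" "(\<Sum>t=1..T. approx_error f t) \<le> real T * e\<^sup>2"
      using approx_error_small by blast
    have "0 < e"
      using eps e by linarith
    \<comment> \<open>In place of Cauchy--Schwarz over the rounds, this makes the summed errors
      appear linearly. It divides by e, which is positive even if \<epsilon> = 0.\<close>
    have amgm: "2 * sqrt z \<le> z / e + e" if "0 \<le> z" for z
    proof -
      have "0 \<le> (sqrt z - e)\<^sup>2 / e"
        using \<open>0 < e\<close> by simp
      also have "\<dots> = z / e + e - 2 * sqrt z"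
        using \<open>0 < e\<close> that by (simp add: power2_diff field_simps power2_eq_square)
      finally show ?thesis
        by simp
    qed
    have "2 * (\<Sum>t=1..T. sqrt (approx_error f t)) \<le> (\<Sum>t=1..T. approx_error f t / e + e)"
      unfolding sum_distrib_left by (intro sum_mono amgm approx_error_nonneg)
    also have "\<dots> = (\<Sum>t=1..T. approx_error f t) / e + real T * e"
      by (simp add: sum.distrib sum_divide_distrib)
    also have "\<dots> \<le> real T * e\<^sup>2 / e + real T * e"
      using f(2) \<open>0 < e\<close> by (intro add_right_mono divide_right_mono) auto
    also have "\<dots> = 2 * e * real T"
      using \<open>0 < e\<close> by (simp add: power2_eq_square)
    finally have "2 * (\<Sum>t=1..T. sqrt (approx_error f t)) \<le> 2 * e * real T" .
    moreover have "\<gamma> * (R / 2 + (\<Sum>t=1..T. approx_error f t)) \<le> \<gamma> * (R / 2 + real T * e\<^sup>2)"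
      using f(2) \<gamma> by (intro mult_left_mono) auto
    ultimately show ?thesis
      using bandit_regret_le_approx_error[OF \<gamma> f(1)] by linarith
  qed
  have "((\<lambda>e. 2 * e * real T + real CARD('d) * real T / \<gamma> + \<gamma> * (R / 2 + real T * e\<^sup>2))
      \<longlongrightarrow> 2 * \<epsilon> * real T + real CARD('d) * real T / \<gamma> + \<gamma> * (R / 2 + real T * \<epsilon>\<^sup>2)) (at_right \<epsilon>)"
    by (intro tendsto_intros) (use \<gamma> in auto)
  then show ?thesis
    by (rule tendsto_lowerbound) (auto simp: eventually_at_right_less intro!: le
        eventually_mono[OF eventually_at_right_less])
qed

text \<open>For the greedy strategy the comparator \<open>b\<close> is never explored, and \<open>b \<bullet> \<theta>\<close> is only controlled by
  the diverted plays of \<open>prediction_error_off_policy\<close>.\<close>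

lemma bandit_regret_le_of_greedy:
  assumes \<gamma>: "\<gamma> = 0" and eps: "0 \<le> \<epsilon>" "misspecification F \<mu> T x A \<le> \<epsilon>"
  shows "bandit_regret M T x A \<mu> a \<le> 2 * real T * sqrt (R + real T * \<epsilon>\<^sup>2)"
proof -
  have le: "bandit_regret M T x A \<mu> a \<le> 2 * real T * sqrt (R + real T * e\<^sup>2)" if e: "\<epsilon> < e" for e
  proof -
    have "misspecification F \<mu> T x A < e"
      using eps e by linarith
    then obtain f where f: "f \<in> F" "(\<Sum>t=1..T. approx_error f t) \<le> real T * e\<^sup>2"
      using approx_error_small by blast
    let ?s = "R + real T * e\<^sup>2"
    \<comment> \<open>One root pays for the prediction error at the comparator and one for that at
      the played action; greediness compares the two predicted values.\<close>
    have "bandit_regret M T x A \<mu> a \<le> (\<Sum>t=1..T. 2 * sqrt ?s)"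
    proof (rule bandit_regret_le)
      fix t b assume t: "t \<in> {1..T}" and b: "b \<in> A t"
      let ?m = "\<lambda>\<omega>. \<mu> (a t \<omega>) (x t)"
      have bd: "bounded_rv M (\<lambda>\<omega>. a t \<omega> \<bullet> \<theta> t \<omega> - ?m \<omega>)" "bounded_rv M (\<lambda>\<omega>. b \<bullet> \<theta> t \<omega> - \<mu> b (x t))"
        by (intro bounded_rv_diff bounded_rvs t)+
      have "expectation (\<lambda>\<omega>. (b \<bullet> \<theta> t \<omega> - \<mu> b (x t))\<^sup>2) \<le> ?s"
        using prediction_error_off_policy[OF f(1) t b] f(2) by linarith
      then have 1: "\<bar>expectation (\<lambda>\<omega>. b \<bullet> \<theta> t \<omega> - \<mu> b (x t))\<bar> \<le> sqrt ?s"
        by (rule expectation_le_sqrt[OF bd(2)])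
      \<comment> \<open>The on-policy bound holds only for the sum over all rounds, so a single
        squared error is estimated by that sum.\<close>
      have "expectation (\<lambda>\<omega>. (a t \<omega> \<bullet> \<theta> t \<omega> - ?m \<omega>)\<^sup>2)
          \<le> (\<Sum>s=1..T. expectation (\<lambda>\<omega>. (a s \<omega> \<bullet> \<theta> s \<omega> - \<mu> (a s \<omega>) (x s))\<^sup>2))"
        by (rule member_le_sum[OF t]) auto
      also have "\<dots> \<le> R + (\<Sum>s=1..T. expectation (\<lambda>\<omega>. (a s \<omega> \<bullet> f (x s) - \<mu> (a s \<omega>) (x s))\<^sup>2))"
        using prediction_error_on_policy[OF f(1)] by (simp add: sum_subtractf)
      also have "\<dots> \<le> R + (\<Sum>s=1..T. approx_error f s)"
        by (intro add_left_mono sum_mono expectation_approx_error_le)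
      also have "\<dots> \<le> ?s"
        using f(2) by simp
      finally have 2: "\<bar>expectation (\<lambda>\<omega>. a t \<omega> \<bullet> \<theta> t \<omega> - ?m \<omega>)\<bar> \<le> sqrt ?s"
        by (rule expectation_le_sqrt[OF bd(1)])
      have "expectation (\<lambda>\<omega>. a t \<omega> \<bullet> \<theta> t \<omega>) = expectation (\<lambda>\<omega>. mean_action (p t \<omega>) \<bullet> \<theta> t \<omega>)"
        by (rule expectation_inner_mean_action(2)[OF t \<theta>_component[OF t]])
      also have "\<dots> \<le> expectation (\<lambda>\<omega>. b \<bullet> \<theta> t \<omega>)"
      proof (rule expectation_mono)
        show "bounded_rv M (\<lambda>\<omega>. mean_action (p t \<omega>) \<bullet> \<theta> t \<omega>)"
          by (rule bounded_rv_subalgebra[OF past_subalgebra expectation_inner_mean_action(1)[OF t \<theta>_component[OF t]]])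
        show "bounded_rv M (\<lambda>\<omega>. b \<bullet> \<theta> t \<omega>)"
          by (rule bounded_rvs(3)[OF t])
        show "mean_action (p t \<omega>) \<bullet> \<theta> t \<omega> \<le> b \<bullet> \<theta> t \<omega>" if "\<omega> \<in> space M" for \<omega>
          using logdet_barrier_zero_greedy[of "p t \<omega>" "\<theta> t \<omega>" "A t" b] p_barrier[OF t that] b \<gamma> by simp
      qed
      finally have 3: "expectation (\<lambda>\<omega>. a t \<omega> \<bullet> \<theta> t \<omega>) \<le> expectation (\<lambda>\<omega>. b \<bullet> \<theta> t \<omega>)" .
      have "expectation (\<lambda>\<omega>. a t \<omega> \<bullet> \<theta> t \<omega> - ?m \<omega>) = expectation (\<lambda>\<omega>. a t \<omega> \<bullet> \<theta> t \<omega>) - expectation ?m"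
        by (intro Bochner_Integration.integral_diff bounded_rv_integrable bounded_rvs t)
      moreover have "expectation (\<lambda>\<omega>. b \<bullet> \<theta> t \<omega> - \<mu> b (x t)) = expectation (\<lambda>\<omega>. b \<bullet> \<theta> t \<omega>) - \<mu> b (x t)"
        using bounded_rv_integrable[OF bounded_rvs(3)[OF t, of b]] by (simp add: prob_space)
      ultimately show "expectation ?m - \<mu> b (x t) \<le> 2 * sqrt ?s"
        using 1 2 3 by linarith
    qed
    then show ?thesis
      by simp
  qed
  have "((\<lambda>e. 2 * real T * sqrt (R + real T * e\<^sup>2)) \<longlongrightarrow> 2 * real T * sqrt (R + real T * \<epsilon>\<^sup>2)) (at_right \<epsilon>)"
    by (intro tendsto_intros)
  then show ?thesis
    by (rule tendsto_lowerbound) (auto intro!: le eventually_mono[OF eventually_at_right_less])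
qed

end

section \<open>Choice of the learning rate\<close>

theorem theorem2:
  fixes M :: "'w measure"
    and X :: "'x set"
    and T :: nat
    and x :: "nat \<Rightarrow> 'x"
    and A :: "nat \<Rightarrow> (real^'d) set"
    and \<mu> :: "real^'d \<Rightarrow> 'x \<Rightarrow> real"
    and H :: "nat \<Rightarrow> 'w measure"
    and a :: "nat \<Rightarrow> 'w \<Rightarrow> real^'d"
    and l :: "nat \<Rightarrow> 'w \<Rightarrow> real"
    and F :: "('x \<Rightarrow> real^'d) set"
    and orc :: "('x, 'd) regression_oracle"
    and RegSq :: "nat \<Rightarrow> real"
    and c \<epsilon> :: real
  assumes protocol: "contextual_bandit M X T x A \<mu> H a l"
    and F_nonempty: "F \<noteq> {}"
    and eps_nonneg: "0 \<le> \<epsilon>"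
    and c_pos: "0 < c"
    and RegSq_mono: "mono RegSq"
    and oracle_bound: "square_loss_oracle orc X F T (RegSq T)"
    and algorithm:
      "squarecb_lin M H T x A orc
         (c * sqrt (real CARD('d) * real T / (RegSq T + \<epsilon>\<^sup>2 * real T))) a l"
    and misspec: "misspecification F \<mu> T x A \<le> \<epsilon>"
  shows "bandit_regret M T x A \<mu> a
           \<le> 2 * (c + 1 / c) *
             (sqrt (real CARD('d) * real T * RegSq T) + \<epsilon> * sqrt (real CARD('d)) * real T)"
proof -
  let ?d = "real CARD('d)"
  define R where "R = RegSq T"
  define D where "D = R + \<epsilon>\<^sup>2 * real T"
  define \<gamma> where "\<gamma> = c * sqrt (?d * real T / D)"
  \<comment> \<open>The target rate: for \<open>D\<close> > 0, d T / \<gamma> = s / c and \<gamma> D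
    = c s, so exploration and estimation are balanced up to the constant c.\<close>
  define s where "s = sqrt (?d * real T * D)"
  have "squarecb_lin M H T x A orc \<gamma> a l"
    using algorithm by (simp only: \<gamma>_def D_def R_def)
  then obtain \<theta> p where run: "\<forall>t\<in>{1..T}.
      (\<forall>\<omega>\<in>space M. \<theta> t \<omega> = oracle_prediction orc x (\<lambda>s. a s \<omega>) (\<lambda>s. l s \<omega>) t) \<and>
      \<theta> t \<in> borel_measurable (H t) \<and>
      (\<forall>\<omega>\<in>space M. p t \<omega> \<in> logdet_barrier (\<theta> t \<omega>) \<gamma> (A t)) \<and>
      (\<forall>B\<in>sets borel. (\<lambda>\<omega>. measure_pmf.prob (p t \<omega>) B) \<in> borel_measurable (H t) \<and>
         (AE \<omega> in M. real_cond_exp M (H t) (\<lambda>\<omega>. indicator B (a t \<omega>)) \<omega> = measure_pmf.prob (p t \<omega>) B))"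
    unfolding squarecb_lin_def by (elim exE) (rule that)
  interpret squarecb_run M X T x A \<mu> H a l F orc R \<gamma> \<theta> p
  proof (intro squarecb_run.intro protocol squarecb_run_axioms.intro F_nonempty)
    show "square_loss_oracle orc X F T R"
      using oracle_bound by (simp only: R_def)
  qed (use run in blast)+
  have T: "0 < real T"
    using horizon_pos by simp
  have "0 \<le> D"
    unfolding D_def using R_nonneg by simp
  \<comment> \<open>Together with 1 \<le> sqrt d, this absorbs the term 2 \<epsilon> T for every c >
    0.\<close>
  have c2: "2 \<le> c + 1 / c"
  proof -
    have "0 \<le> (c - 1)\<^sup>2 / c"
      using c_pos by simp
    also have "\<dots> = c + 1 / c - 2"
      using c_pos by (simp add: power2_eq_square field_simps)
    finally show ?thesis
      by simp
  qed
  have s_le: "s \<le> sqrt (?d * real T * R) + \<epsilon> * sqrt ?d * real T"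
  proof -
    have "s = sqrt (?d * real T * R + ?d * (\<epsilon> * real T)\<^sup>2)"
      by (simp add: s_def D_def power2_eq_square algebra_simps)
    also have "\<dots> \<le> sqrt (?d * real T * R) + sqrt (?d * (\<epsilon> * real T)\<^sup>2)"
      using R_nonneg by (intro sqrt_add_le_add_sqrt) auto
    also have "sqrt (?d * (\<epsilon> * real T)\<^sup>2) = \<epsilon> * sqrt ?d * real T"
      using eps_nonneg by (simp add: real_sqrt_mult)
    finally show ?thesis .
  qed
  show ?thesis
  proof (cases "D = 0")
    case True
    then have "\<epsilon>\<^sup>2 * real T = 0" "R = 0"
      using R_nonneg by (auto simp: D_def add_nonneg_eq_0_iff)
    \<comment> \<open>Division by 0 gives 0, so \<gamma> = 0 and the greedy bound applies; its
      right-hand side vanishes with \<open>R\<close> and \<epsilon>^2 T.\<close>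
    then have "bandit_regret M T x A \<mu> a \<le> 0"
      using bandit_regret_le_of_greedy[OF _ eps_nonneg misspec] True T by (simp add: \<gamma>_def mult.commute)
    also have "0 \<le> 2 * (c + 1 / c) * (sqrt (?d * real T * RegSq T) + \<epsilon> * sqrt ?d * real T)"
      using c_pos eps_nonneg R_nonneg by (simp add: R_def)
    finally show ?thesis .
  next
    case False
    then have D: "0 < D"
      using \<open>0 \<le> D\<close> by simp
    have \<gamma>: "0 < \<gamma>"
      using c_pos D T by (simp add: \<gamma>_def)
    have "0 < s"
      using D T by (simp add: s_def)
    have \<gamma>s: "\<gamma> * D = c * s"
      using D by (simp add: \<gamma>_def s_def real_sqrt_divide real_sqrt_mult real_div_sqrt field_simps)
    have ss: "s * s = ?d * real T * D"
      using D by (simp add: s_def)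
    have "?d * real T / \<gamma> = s * s / (\<gamma> * D)"
      using D by (simp add: ss)
    also have "\<dots> = s / c"
      using \<open>0 < s\<close> by (simp add: \<gamma>s)
    finally have explore: "?d * real T / \<gamma> = s / c" .
    have "\<gamma> * (R / 2 + real T * \<epsilon>\<^sup>2) \<le> \<gamma> * D"
      using \<gamma> R_nonneg by (intro mult_left_mono) (auto simp: D_def)
    then have "bandit_regret M T x A \<mu> a \<le> 2 * \<epsilon> * real T + (s / c + c * s)"
      using bandit_regret_le_of_pos[OF \<gamma> eps_nonneg misspec] unfolding explore \<gamma>s by linarith
    also have "s / c + c * s = (c + 1 / c) * s"
      by (simp add: algebra_simps)
    also have "2 * \<epsilon> * real T \<le> (c + 1 / c) * (\<epsilon> * sqrt ?d * real T)"
    proof -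
      have "2 * (\<epsilon> * 1 * real T) \<le> (c + 1 / c) * (\<epsilon> * sqrt ?d * real T)"
        using c2 c_pos eps_nonneg by (intro mult_mono mult_nonneg_nonneg) (auto simp: Suc_le_eq)
      then show ?thesis
        by simp
    qed
    also have "\<dots> \<le> (c + 1 / c) * (sqrt (?d * real T * R) + \<epsilon> * sqrt ?d * real T)"
      using c_pos R_nonneg by (intro mult_left_mono) auto
    finally have "bandit_regret M T x A \<mu> a \<le> (c + 1 / c) * (sqrt (?d * real T * R) + \<epsilon> * sqrt ?d * real T) + (c + 1 / c) * s"
      by simp
    also have "(c + 1 / c) * s \<le> (c + 1 / c) * (sqrt (?d * real T * R) + \<epsilon> * sqrt ?d * real T)"
      using c_pos s_le by (intro mult_left_mono) auto
    finally show ?thesis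
      unfolding R_def by linarith
  qed
qed

end
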